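(* The function $G:[0,1]\to[0,1]$, the limit of the normalized numbers of nonzero states of $T_b$ (defined in the context), is given by $$G(x)=\sum_{i=0}^{\infty}x_i\,4^{\sum_{j=0}^{i-1}x_j}\left(\frac{3}{2}\left(\sum_{j=i}^{\infty}\frac{1-x_j}{2^j}\right)^2-\frac{1}{2\cdot4^i}\prod_{j=i+1}^{\infty}(1-x_j)\right),$$ where $x=\sum_{i=0}^{\infty}x_i2^{-i}$ with $x_i\in\{0,1\}$ is the binary expansion of $x$, and the finite binary expansion is adopted if $x\in[0,1]$ has two binary expansions.
   Context: A two-dimensional elementary cellular automaton is a map $T:\{0,1\}^{\mathbb{Z}^2}\to\{0,1\}^{\mathbb{Z}^2}$ such that $(Tx)_{i,j}$ is given by a fixed local rule $f:\{0,1\}^5\to\{0,1\}$ applied to the center $C=x_{i,j}$ and its four von Neumann neighbors $U=x_{i,j+1}$, $D=x_{i,j-1}$, $L=x_{i-1,j}$, $R=x_{i+1,j}$. It is symmetrical if $f$ is invariant under left-right and top-bottom reflections and under rotations by multiples of $90^\circ$ of the four neighbors. Call two neighbors opposite if they are $\{U,D\}$ or $\{L,R\}$, and adjacent otherwise. $T_b$ denotes any symmetrical two-dimensional elementary cellular automaton whose local rule satisfies the following. If $C=0$: output $0$ if no neighbor is $1$; output $1$ if exactly one neighbor is $1$; output $0$ if exactly two neighbors are $1$ and they are adjacent; output $1$ if all four neighbors are $1$; the output is arbitrary if exactly two opposite neighbors, or exactly three neighbors, are $1$. If $C=1$: output $1$ if no neighbor is $1$; output $1$ if exactly one neighbor is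 $1$; output $0$ if exactly two neighbors are $1$ and they are adjacent; output $1$ if exactly two neighbors are $1$ and they are opposite; output $1$ if all four neighbors are $1$; the output is arbitrary if exactly three neighbors are $1$. (The arbitrary values, chosen compatibly with the symmetry, do not affect the orbit considered.) The single site seed $x_o\in\{0,1\}^{\mathbb{Z}^2}$ has $(x_o)_{0,0}=1$ and all other entries $0$. Define $num_b(0)=0$ and, for $t\ge1$, $num_b(t)=\sum_{(i,j)\in\mathbb{Z}^2}(T_b^{t-1}x_o)_{i,j}$. Binary expansions: $x\in[0,1]$ is written $x=\sum_{i=0}^{\infty}x_i2^{-i}$, $x_i\in\{0,1\}$, using the finite expansion whenever there are two (so $x_0=1$ only for $x=1$). For $k>0$ and $x=t/2^k$ with $t$ an integer, $0\le t\le2^k$, put $G_k(x)=num_b(t)/num_b(2^k)$. For $x\in[0,1]$ with truncations $x|_k=\sum_{i=0}^{k}x_i2^{-i}$, $G(x)=\lim_{k\to\infty}G_k(x|_k)$. Empty sums are $0$. *)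

theory Defs
  imports "HOL-Analysis.Analysis"
begin

type_synonym local_rule = "bool \<Rightarrow> bool \<Rightarrow> bool \<Rightarrow> bool \<Rightarrow> bool \<Rightarrow> bool"
type_synonym config = "int \<times> int \<Rightarrow> bool"

text \<open>The states 0 and 1 are \<^const>\<open>False\<close> and \<^const>\<open>True\<close>; the arguments of a local rule are,
  in this order, \<open>C\<close>, \<open>U\<close>, \<open>D\<close>, \<open>L\<close>, \<open>R\<close>.\<close>

definition eca :: "local_rule \<Rightarrow> config \<Rightarrow> config" where
  "eca f x = (\<lambda>(i, j). f (x (i, j)) (x (i, j + 1)) (x (i, j - 1)) (x (i - 1, j)) (x (i + 1, j)))"

text \<open>The conjuncts are the left-right reflection, the top-bottom reflection and the quarter turn
  (\<open>R\<close> to \<open>U\<close>, \<open>L\<close> to \<open>D\<close>, \<open>U\<close> to \<open>L\<close>, \<open>D\<close> to \<open>R\<close>), whose iterates are the other rotations.\<close>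

definition symmetrical :: "local_rule \<Rightarrow> bool" where
  "symmetrical f \<longleftrightarrow>
     (\<forall>c u d l r. f c u d r l = f c u d l r \<and> f c d u l r = f c u d l r \<and> f c r l u d = f c u d l r)"

definition num_ones :: "bool \<Rightarrow> bool \<Rightarrow> bool \<Rightarrow> bool \<Rightarrow> nat" where
  "num_ones u d l r = of_bool u + of_bool d + of_bool l + of_bool r"

definition two_opposite :: "bool \<Rightarrow> bool \<Rightarrow> bool \<Rightarrow> bool \<Rightarrow> bool" where
  "two_opposite u d l r \<longleftrightarrow> (u \<and> d \<and> \<not> l \<and> \<not> r) \<or> (\<not> u \<and> \<not> d \<and> l \<and> r)"

definition two_adjacent :: "bool \<Rightarrow> bool \<Rightarrow> bool \<Rightarrow> bool \<Rightarrow> bool" where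
  "two_adjacent u d l r \<longleftrightarrow> num_ones u d l r = 2 \<and> \<not> two_opposite u d l r"

definition Tb_rule :: "local_rule \<Rightarrow> bool" where
  "Tb_rule f \<longleftrightarrow> symmetrical f \<and> (\<forall>u d l r.
     (num_ones u d l r = 0 \<longrightarrow> \<not> f False u d l r) \<and>
     (num_ones u d l r = 1 \<longrightarrow> f False u d l r) \<and>
     (two_adjacent u d l r \<longrightarrow> \<not> f False u d l r) \<and>
     (num_ones u d l r = 4 \<longrightarrow> f False u d l r) \<and>
     (num_ones u d l r = 0 \<longrightarrow> f True u d l r) \<and>
     (num_ones u d l r = 1 \<longrightarrow> f True u d l r) \<and>
     (two_adjacent u d l r \<longrightarrow> \<not> f True u d l r) \<and>
     (two_opposite u d l r \<longrightarrow> f True u d l r) \<and>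
     (num_ones u d l r = 4 \<longrightarrow> f True u d l r))"

definition seed :: config where
  "seed = (\<lambda>p. p = (0, 0))"

definition num_b :: "local_rule \<Rightarrow> nat \<Rightarrow> nat" where
  "num_b f t = (if t = 0 then 0 else \<Sum>\<^sub>\<infinity>p. of_bool ((eca f ^^ (t - 1)) seed p))"

definition is_binary_expansion :: "(nat \<Rightarrow> nat) \<Rightarrow> real \<Rightarrow> bool" where
  "is_binary_expansion d x \<longleftrightarrow> (\<forall>i. d i \<in> {0, 1}) \<and> (\<lambda>i. real (d i) / 2 ^ i) sums x"

definition is_chosen_expansion :: "(nat \<Rightarrow> nat) \<Rightarrow> real \<Rightarrow> bool" where
  "is_chosen_expansion d x \<longleftrightarrow> is_binary_expansion d x \<and>
     ((\<exists>e. e \<noteq> d \<and> is_binary_expansion e x) \<longrightarrow> finite {i. d i \<noteq> 0})"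

definition bdigit :: "real \<Rightarrow> nat \<Rightarrow> nat" where
  "bdigit x = (THE d. is_chosen_expansion d x)"

definition trunc :: "nat \<Rightarrow> real \<Rightarrow> real" where
  "trunc k x = (\<Sum>i\<le>k. real (bdigit x i) / 2 ^ i)"

text \<open>Used only at \<open>x = t / 2 ^ k\<close> with \<open>t\<close> a natural number, where \<open>\<lfloor>x * 2 ^ k\<rfloor>\<close> is \<open>t\<close>.\<close>

definition G_approx :: "local_rule \<Rightarrow> nat \<Rightarrow> real \<Rightarrow> real" where
  "G_approx f k x = real (num_b f (nat \<lfloor>x * 2 ^ k\<rfloor>)) / real (num_b f (2 ^ k))"

definition G :: "local_rule \<Rightarrow> real \<Rightarrow> real" where
  "G f x = lim (\<lambda>k. G_approx f k (trunc k x))"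

text \<open>The limit of the partial products. \<^const>\<open>prodinf\<close> is not usable here: a product with
  infinitely many zero factors is not convergent in the sense of \<^const>\<open>has_prod\<close>.\<close>

definition inf_prod_from :: "nat \<Rightarrow> (nat \<Rightarrow> real) \<Rightarrow> real" where
  "inf_prod_from m a = lim (\<lambda>n. \<Prod>j=m..n. a j)"

text \<open>The definite description in \<^const>\<open>bdigit\<close> is well defined on \<open>[0, 1]\<close>.\<close>

lemma binary_expansion_first_difference:
  assumes d: "is_binary_expansion d x" and e: "is_binary_expansion e x"
    and "d m = 1" "e m = 0" and eq: "\<And>i. i < m \<Longrightarrow> d i = e i" and "m < i"
  shows "d i = 0 \<and> e i = 1"
proof -
  let ?g = "\<lambda>i. (real (d i) - real (e i)) / 2 ^ i"
  let ?h = "\<lambda>i. (1 + real (d (i + Suc m)) - real (e (i + Suc m))) / 2 ^ (i + Suc m)"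
  have "?g sums (x - x)"
    using sums_diff[of "\<lambda>i. real (d i) / 2 ^ i" x "\<lambda>i. real (e i) / 2 ^ i" x] d e
    unfolding is_binary_expansion_def by (simp add: diff_divide_distrib)
  then have "(\<lambda>i. ?g (i + Suc m)) sums (0 - (\<Sum>i<Suc m. ?g i))"
    by (subst sums_iff_shift) simp
  moreover have "(\<Sum>i<Suc m. ?g i) = 1 / 2 ^ m"
    using assms(3,4) eq by simp
  moreover have "(\<lambda>i. (1 / 2 ^ Suc m) * (1 / 2) ^ i :: real) sums ((1 / 2 ^ Suc m) * (1 / (1 - 1 / 2)))"
    by (intro sums_mult geometric_sums) simp
  ultimately have "(\<lambda>i. ?g (i + Suc m) + (1 / 2 ^ Suc m) * (1 / 2) ^ i)
      sums ((0 - 1 / 2 ^ m) + (1 / 2 ^ Suc m) * (1 / (1 - 1 / 2)))"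
    using sums_add by fastforce
  also have "(\<lambda>i. ?g (i + Suc m) + (1 / 2 ^ Suc m) * (1 / 2) ^ i) = ?h"
    by (auto simp: field_simps power_add)
  finally have "?h sums 0" by simp
  moreover have nonneg: "0 \<le> ?h i" for i
  proof -
    have "e (i + Suc m) \<in> {0, 1}" using e unfolding is_binary_expansion_def by blast
    then show ?thesis by auto
  qed
  ultimately have "\<forall>i. ?h i = 0"
    using suminf_eq_zero_iff[of ?h] by (simp add: sums_iff)
  then have "?h (i - Suc m) = 0" by blast
  then have "1 + real (d i) - real (e i) = 0" using \<open>m < i\<close> by simp
  moreover have "e i \<in> {0, 1}" using e unfolding is_binary_expansion_def by blast
  ultimately show ?thesis by auto
qed

lemma binary_expansions_differ:
  assumes d: "is_binary_expansion d x" and e: "is_binary_expansion e x" and "d \<noteq> e"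
  obtains m where "\<And>i. m < i \<Longrightarrow> d i = 0 \<and> e i = 1" | m where "\<And>i. m < i \<Longrightarrow> d i = 1 \<and> e i = 0"
proof -
  define m where "m = (LEAST i. d i \<noteq> e i)"
  have "\<exists>i. d i \<noteq> e i" using \<open>d \<noteq> e\<close> by auto
  then have m: "d m \<noteq> e m" unfolding m_def by (rule LeastI_ex)
  have eq: "d i = e i" if "i < m" for i using that not_less_Least unfolding m_def by blast
  have "d m \<in> {0, 1}" "e m \<in> {0, 1}" using d e unfolding is_binary_expansion_def by blast+
  with m consider "d m = 1" "e m = 0" | "e m = 1" "d m = 0" by auto
  then show thesis
  proof cases
    case 1
    show thesis by (rule that(1)[of m]) (use binary_expansion_first_difference[OF d e 1] eq in auto)
  next
    case 2
    show thesis by (rule that(2)[of m]) (use binary_expansion_first_difference[OF e d 2] eq in auto)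
  qed
qed

lemma infinite_if_eventually_one: "(\<And>i::nat. m < i \<Longrightarrow> d i = (1::nat)) \<Longrightarrow> infinite {i. d i \<noteq> 0}"
  using infinite_Ioi[of m] finite_subset[of "{m<..}" "{i. d i \<noteq> 0}"] by force

lemma binary_expansion_exists:
  assumes "0 \<le> x" "x \<le> 1"
  shows "\<exists>d. is_binary_expansion d x"
proof -
  define d where "d i = nat (\<lfloor>x * 2 ^ i\<rfloor> mod 2)" for i
  have *: "(\<Sum>i<Suc n. real (d i) / 2 ^ i) = of_int \<lfloor>x * 2 ^ n\<rfloor> / 2 ^ n" for n
  proof (induction n)
    case 0
    have "\<lfloor>x\<rfloor> = 0 \<or> \<lfloor>x\<rfloor> = 1" using assms by linarith
    then show ?case unfolding d_def by auto
  next
    case (Suc n)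
    have "\<lfloor>x * 2 ^ Suc n\<rfloor> div 2 = \<lfloor>x * 2 ^ n\<rfloor>"
      using floor_divide_real_eq_div[of 2 "x * 2 ^ Suc n"] by simp
    then have "\<lfloor>x * 2 ^ Suc n\<rfloor> = 2 * \<lfloor>x * 2 ^ n\<rfloor> + int (d (Suc n))"
      unfolding d_def using mult_div_mod_eq[of 2 "\<lfloor>x * 2 ^ Suc n\<rfloor>"] by simp
    then show ?case using Suc by (simp add: field_simps)
  qed
  have "(\<lambda>n. of_int \<lfloor>x * 2 ^ n\<rfloor> / 2 ^ n :: real) \<longlonglongrightarrow> x"
  proof (rule real_tendsto_sandwich)
    have "(\<lambda>n. x - (1/2) ^ n) \<longlonglongrightarrow> x - 0"
      by (intro tendsto_diff tendsto_const LIMSEQ_power_zero) simp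
    then show "(\<lambda>n. x - (1/2) ^ n) \<longlonglongrightarrow> x" by simp
    show "\<forall>\<^sub>F n in sequentially. x - (1/2) ^ n \<le> of_int \<lfloor>x * 2 ^ n\<rfloor> / 2 ^ n"
    proof (intro always_eventually allI)
      fix n
      have "(x * 2 ^ n - 1) / 2 ^ n \<le> of_int \<lfloor>x * 2 ^ n\<rfloor> / 2 ^ n"
        by (rule divide_right_mono) (linarith, simp)
      then show "x - (1/2) ^ n \<le> of_int \<lfloor>x * 2 ^ n\<rfloor> / 2 ^ n"
        by (simp add: diff_divide_distrib power_one_over)
    qed
    show "\<forall>\<^sub>F n in sequentially. of_int \<lfloor>x * 2 ^ n\<rfloor> / 2 ^ n \<le> x"
      by (intro always_eventually allI) (simp add: divide_le_eq)
  qed simp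
  then have "(\<lambda>i. real (d i) / 2 ^ i) sums x"
    unfolding sums_def by (subst filterlim_sequentially_Suc[symmetric]) (simp only: *)
  moreover have "d i \<in> {0, 1}" for i unfolding d_def by auto
  ultimately show ?thesis unfolding is_binary_expansion_def by blast
qed

lemma chosen_expansion_ex1:
  assumes "0 \<le> x" "x \<le> 1"
  shows "\<exists>!d. is_chosen_expansion d x"
proof (rule ex_ex1I)
  obtain d where d: "is_binary_expansion d x" using binary_expansion_exists assms by blast
  show "\<exists>d. is_chosen_expansion d x"
  proof (cases "\<exists>e. e \<noteq> d \<and> is_binary_expansion e x")
    case True
    then obtain e where e: "is_binary_expansion e x" "d \<noteq> e" by auto
    have fin: "finite {i. a i \<noteq> 0}" if "\<And>i. m < i \<Longrightarrow> a i = 0" for a :: "nat \<Rightarrow> nat" and m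
      by (rule finite_subset[of _ "{..m}"]) (use that in \<open>auto simp flip: not_less\<close>)
    from d e show ?thesis
      by (rule binary_expansions_differ)
         (use d e fin in \<open>unfold is_chosen_expansion_def, blast+\<close>)
  next
    case False
    then show ?thesis using d unfolding is_chosen_expansion_def by blast
  qed
next
  fix d e assume de: "is_chosen_expansion d x" "is_chosen_expansion e x"
  show "d = e"
  proof (rule ccontr)
    assume "d \<noteq> e"
    with de have fin: "finite {i. d i \<noteq> 0}" "finite {i. e i \<noteq> 0}"
      and bin: "is_binary_expansion d x" "is_binary_expansion e x"
      unfolding is_chosen_expansion_def by metis+
    from bin \<open>d \<noteq> e\<close> show False
      by (rule binary_expansions_differ) (use fin infinite_if_eventually_one in blast)+
  qed
qed

lemma bdigit_chosen_expansion:
  assumes "0 \<le> x" "x \<le> 1"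
  shows "is_chosen_expansion (bdigit x) x"
  unfolding bdigit_def using chosen_expansion_ex1[OF assms] by (rule theI')

end

theory Submission
  imports Defs
begin

text \<open>Put \<open>N = 2 ^ k\<close>. At time \<open>N\<close> every site of odd coordinate sum in the open
  \<open>l\<^sub>1\<close>-ball of radius \<open>N\<close> is 1 and every site with two odd coordinates is 0. Parity alone then
  forces the next configuration: the full closed ball of radius \<open>N - 1\<close> together with its four
  tips at distance \<open>N\<close>. From then on the ball loses one layer per step while each tip grows an
  undisturbed copy of the orbit of the seed; the only contact is along the axes, where the ball
  hands its tip over to the copy. After \<open>N\<close> steps only the centre of the ball is left and the
  parity pattern reappears at the scale \<open>2 * N\<close>. Counting gives, for \<open>1 \<le> s \<le> N\<close> and
  \<open>r = N - s\<close>, \<open>num (N + s) = 4 * num s + 2 * r\<^sup>2 + 2 * r + 1\<close>.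
  Applying this at each binary digit 1 of \<open>x\<close> yields the terms of the series; the product in the
  formula corrects the case \<open>s = 0\<close>, where the recursion fails. The remainder after \<open>n\<close> digits is
  of order \<open>4\<close> to the power minus the number of zeros among them, and an adopted expansion has
  infinitely many zeros.\<close>

subsection \<open>The orbit of the seed\<close>

definition orbit :: "local_rule \<Rightarrow> nat \<Rightarrow> config" where
  "orbit f t = (eca f ^^ t) seed"

definition rotation_invariant :: "config \<Rightarrow> bool" where
  "rotation_invariant c \<longleftrightarrow> (\<forall>x y. c (- y, x) = c (x, y))"

text \<open>In use \<open>n = r + t + 1\<close> and \<open>c\<close> has radius \<open>t\<close>:
  ball and copies are then disjoint, and they are adjacent only where their tips meet on the
  axes.\<close>

definition ball_with_copies :: "int \<Rightarrow> int \<Rightarrow> config \<Rightarrow> config" where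
  "ball_with_copies n r c = (\<lambda>(x, y). \<bar>x\<bar> + \<bar>y\<bar> \<le> r \<or>
     c (x - n, y) \<or> c (x + n, y) \<or> c (x, y - n) \<or> c (x, y + n))"

lemma orbit_0: "orbit f 0 = seed"
  and orbit_Suc: "orbit f (Suc t) = eca f (orbit f t)"
  by (simp_all add: orbit_def)

text \<open>One fact per neighbourhood on which \<open>Tb_rule\<close> fixes the output, so that the
  simplifier evaluates \<open>f\<close> as soon as the relevant cells are known.\<close>

lemma Tb_rule_values:
  assumes "Tb_rule f"
  shows "\<not> f False False False False False"
    and "f False True False False False" "f False False True False False"
    and "f False False False True False" "f False False False False True"
    and "\<not> f False True False True False" "\<not> f False False True True False"
    and "\<not> f False True False False True" "\<not> f False False True False True"
    and "f False True True True True"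
    and "f True False False False False"
    and "f True True False False False" "f True False True False False"
    and "f True False False True False" "f True False False False True"
    and "\<not> f True True False True False" "\<not> f True False True True False"
    and "\<not> f True True False False True" "\<not> f True False True False True"
    and "f True True True False False" "f True False False True True"
    and "f True True True True True"
  using assms unfolding Tb_rule_def num_ones_def two_adjacent_def two_opposite_def
  by (simp_all add: all_bool_eq)

section \<open>Symmetry under the quarter turn\<close>

lemma rotation_invariantD: "rotation_invariant c \<Longrightarrow> c (- y, x) = c (x, y)"
  by (simp add: rotation_invariant_def)

lemma rotation_invariant_half_turn: "rotation_invariant c \<Longrightarrow> c (- x, - y) = c (x, y)"
  using rotation_invariantD[of c y x] rotation_invariantD[of c x "- y"] by simp

lemma rotation_invariant_eca:
  assumes "symmetrical f" "rotation_invariant c"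
  shows "rotation_invariant (eca f c)"
  unfolding rotation_invariant_def
proof (intro allI)
  fix x y
  have "c (- y, x + 1) = c (x + 1, y)" "c (- y, x - 1) = c (x - 1, y)"
    "c (- y - 1, x) = c (x, y + 1)" "c (- y + 1, x) = c (x, y - 1)" "c (- y, x) = c (x, y)"
    using rotation_invariantD[OF assms(2), of "y + 1" x]
      rotation_invariantD[OF assms(2), of "y - 1" x]
    by (simp_all add: rotation_invariantD[OF assms(2)])
  then show "eca f c (- y, x) = eca f c (x, y)"
    using assms(1) unfolding eca_def symmetrical_def by simp
qed

lemma rotation_invariant_orbit: "symmetrical f \<Longrightarrow> rotation_invariant (orbit f t)"
proof (induction t)
  case 0
  show ?case by (auto simp: rotation_invariant_def orbit_0 seed_def)
qed (simp add: orbit_Suc rotation_invariant_eca)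

lemma rotation_invariant_ball_with_copies:
  assumes "rotation_invariant c"
  shows "rotation_invariant (ball_with_copies n r c)"
  unfolding rotation_invariant_def
proof (intro allI)
  fix x y
  have "- (y + n) = - y - n" "- (y - n) = - y + n" by simp_all
  then have "c (- y - n, x) = c (x, y + n)" "c (- y + n, x) = c (x, y - n)"
    using rotation_invariantD[OF assms] by metis+
  then show "ball_with_copies n r c (- y, x) = ball_with_copies n r c (x, y)"
    unfolding ball_with_copies_def by (auto simp: rotation_invariantD[OF assms] add.commute)
qed

text \<open>The four quarter turns of the cone \<open>\<bar>y\<bar> \<le> x\<close> cover the plane.
  Comparing configurations in this cone leaves only the right-hand copy to deal with.\<close>

lemma rotation_invariant_eqI:
  assumes "rotation_invariant a" "rotation_invariant b"
    and "\<And>x y. \<bar>y\<bar> \<le> x \<Longrightarrow> a (x, y) = b (x, y)"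
  shows "a = b"
proof
  fix p :: "int \<times> int"
  obtain x y where p: "p = (x, y)" by fastforce
  consider "\<bar>y\<bar> \<le> x" | "\<bar>- x\<bar> \<le> y" | "\<bar>- y\<bar> \<le> - x" | "\<bar>x\<bar> \<le> - y" by linarith
  then have "a (x, y) = b (x, y)"
  proof cases
    case 2
    then show ?thesis
      using assms(3)[OF 2] rotation_invariantD[OF assms(1), of "- x" y]
        rotation_invariantD[OF assms(2), of "- x" y] by simp
  next
    case 3
    then show ?thesis
      using assms(3)[OF 3] rotation_invariant_half_turn[OF assms(1)]
        rotation_invariant_half_turn[OF assms(2)] by simp
  next
    case 4
    then show ?thesis
      using assms(3)[OF 4] rotation_invariantD[OF assms(1)] rotation_invariantD[OF assms(2)] by simp
  qed (rule assms(3))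
  then show "a p = b p" by (simp add: p)
qed

section \<open>Light cone and tips of the orbit\<close>

lemma orbit_support:
  assumes "Tb_rule f" "orbit f t (x, y)"
  shows "\<bar>x\<bar> + \<bar>y\<bar> \<le> int t"
  using assms(2)
proof (induction t arbitrary: x y)
  case 0
  then show ?case by (simp add: orbit_0 seed_def)
next
  case (Suc t)
  show ?case
  proof (rule ccontr)
    assume "\<not> ?thesis"
    then have "\<not> orbit f t (x, y)" "\<not> orbit f t (x, y + 1)" "\<not> orbit f t (x, y - 1)"
      "\<not> orbit f t (x - 1, y)" "\<not> orbit f t (x + 1, y)"
      using Suc.IH[of x y] Suc.IH[of x "y + 1"] Suc.IH[of x "y - 1"] Suc.IH[of "x - 1" y]
        Suc.IH[of "x + 1" y] by auto
    then show False
      using Suc.prems Tb_rule_values(1)[OF assms(1)] by (simp add: orbit_Suc eca_def)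
  qed
qed

text \<open>By \<open>orbit_support\<close> the cell just beyond the tip has the tip as its only
  live neighbour, so it is born. The left tip is the one by which the right-hand copy meets the
  ball.\<close>

lemma orbit_tip:
  assumes "Tb_rule f"
  shows "orbit f t (- int t, 0)"
proof (induction t)
  case 0
  show ?case by (simp add: orbit_0 seed_def)
next
  case (Suc t)
  have "\<not> orbit f t (- int (Suc t), 0)" "\<not> orbit f t (- int (Suc t), 1)"
    "\<not> orbit f t (- int (Suc t), - 1)" "\<not> orbit f t (- int (Suc t) - 1, 0)"
    by (auto dest!: orbit_support[OF assms])
  moreover have "orbit f t (- int (Suc t) + 1, 0)" using Suc by simp
  ultimately show ?case
    using Tb_rule_values(5)[OF assms]
    by (simp add: orbit_Suc eca_def del: of_nat_Suc uminus_add_conv_diff)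
qed

section \<open>Erosion of the ball\<close>

text \<open>Off the axes, a cell of the outermost layer and a cell just beyond it both see two
  adjacent live neighbours, so the first dies and the second stays 0. On an axis the ball's tip lies
  between two live cells, survives, and becomes the new tip of the copy.\<close>

lemma eca_ball_with_copies:
  assumes f: "Tb_rule f" and "1 \<le> r" and n: "n = r + int t + 1"
  shows "eca f (ball_with_copies n r (orbit f t)) = ball_with_copies n (r - 1) (orbit f (Suc t))"
    (is "eca f ?a = ?b")
proof (rule rotation_invariant_eqI)
  have sym: "symmetrical f" using f by (simp add: Tb_rule_def)
  show "rotation_invariant ?b"
    by (intro rotation_invariant_ball_with_copies rotation_invariant_orbit sym)
  show "rotation_invariant (eca f ?a)"
    by (intro rotation_invariant_eca rotation_invariant_ball_with_copies rotation_invariant_orbit sym)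
  fix x y :: int
  assume xy: "\<bar>y\<bar> \<le> x"
  let ?c = "orbit f t"
  note supp = orbit_support[OF f]
  \<comment> \<open>The centres of the other three copies are at distance at least \<open>n\<close>,
    hence at least \<open>t + 2\<close>, from the cone. The budget with \<open>t'\<close> covers
    both the neighbours of the site at time \<open>t\<close> and the site itself at time
    \<open>Suc t\<close>.\<close>
  have other_copies: "\<not> orbit f t' (u + n, v)" "\<not> orbit f t' (u, v - n)" "\<not> orbit f t' (u, v + n)"
    if uv: "\<bar>u - x\<bar> + \<bar>v - y\<bar> + int t' \<le> int t + 1" for t' u v
  proof -
    have "\<not> \<bar>u + n\<bar> + \<bar>v\<bar> \<le> int t'" using uv xy assms(2) n by arith
    moreover have "\<not> \<bar>u\<bar> + \<bar>v - n\<bar> \<le> int t'" using uv xy assms(2) n by arith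
    moreover have "\<not> \<bar>u\<bar> + \<bar>v + n\<bar> \<le> int t'" using uv xy assms(2) n by arith
    ultimately show "\<not> orbit f t' (u + n, v)" "\<not> orbit f t' (u, v - n)"
      "\<not> orbit f t' (u, v + n)"
      using supp by blast+
  qed
  have a: "?a (u, v) \<longleftrightarrow> \<bar>u\<bar> + \<bar>v\<bar> \<le> r \<or> ?c (u - n, v)" if "\<bar>u - x\<bar> + \<bar>v - y\<bar> \<le> 1" for u v
    using other_copies[of u v t] that by (simp add: ball_with_copies_def)
  have b: "?b (x, y) \<longleftrightarrow> \<bar>x\<bar> + \<bar>y\<bar> \<le> r - 1 \<or> orbit f (Suc t) (x - n, y)"
    using other_copies[of x y "Suc t"] by (simp add: ball_with_copies_def)
  have c: "u - \<bar>v\<bar> \<ge> r + 1" if "?c (u - n, v)" for u v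
    using supp[OF that] n by linarith
  have c': "x - \<bar>y\<bar> \<ge> r" if "orbit f (Suc t) (x - n, y)"
    using supp[OF that] n by linarith
  have eca_a: "eca f ?a (x, y) = f (?a (x, y)) (?a (x, y + 1)) (?a (x, y - 1)) (?a (x - 1, y)) (?a (x + 1, y))"
    by (simp add: eca_def)
  have inside: "?a (u, v)" if "\<bar>u - x\<bar> + \<bar>v - y\<bar> \<le> 1" "\<bar>u\<bar> + \<bar>v\<bar> \<le> r" for u v
    using a[OF that(1)] that(2) by blast
  have outside: "\<not> ?a (u, v)"
    if "\<bar>u - x\<bar> + \<bar>v - y\<bar> \<le> 1" "\<bar>u\<bar> + \<bar>v\<bar> > r" "u - \<bar>v\<bar> \<le> r" for u v
    using a[OF that(1)] c[of u v] that(2,3) by linarith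
  note vals = Tb_rule_values[OF f]
  have tip: "?c (r + 1 - n, 0)" using orbit_tip[OF f, of t] n by simp
  have tip': "orbit f (Suc t) (r - n, 0)" 
  proof -
    have "r - n = - int (Suc t)" using n by simp
    then show ?thesis using orbit_tip[OF f, of "Suc t"] by simp
  qed
  have "0 \<le> x" using xy by simp
  \<comment> \<open>The regions are: interior of the ball, its outer layer above and below the axis,
    its tip, the next layer above and below the axis, the tip of the copy, and everything farther
    out, where a neighbourhood misses the ball.\<close>
  have "x + \<bar>y\<bar> < r \<or> x + y = r \<and> y > 0 \<or> x - y = r \<and> y < 0 \<or> x = r \<and> y = 0
    \<or> x + y = r + 1 \<and> y > 0 \<or> x - y = r + 1 \<and> y < 0 \<or> x = r + 1 \<and> y = 0 \<or> x + \<bar>y\<bar> > r + 1"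
    by (cases y "0 :: int" rule: linorder_cases) auto
  then consider "x + \<bar>y\<bar> < r" | "x + y = r" "y > 0" | "x - y = r" "y < 0"
    | "x = r" "y = 0" | "x + y = r + 1" "y > 0" | "x - y = r + 1" "y < 0"
    | "x = r + 1" "y = 0" | "x + \<bar>y\<bar> > r + 1"
    by (elim disjE) blast+
  then show "eca f ?a (x, y) = ?b (x, y)"
  proof cases
    case 1
    have "?a (x, y)" "?a (x, y + 1)" "?a (x, y - 1)" "?a (x - 1, y)" "?a (x + 1, y)"
      by (rule inside outside; use 1 xy \<open>0 \<le> x\<close> assms(2) in arith)+
    then show ?thesis unfolding eca_a b using 1 \<open>0 \<le> x\<close> vals by simp
  next
    case 2
    have "?a (x, y)" "\<not> ?a (x, y + 1)" "?a (x, y - 1)" "?a (x - 1, y)" "\<not> ?a (x + 1, y)"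
      by (rule inside outside; use 2 xy \<open>0 \<le> x\<close> assms(2) in arith)+
    then show ?thesis unfolding eca_a b using 2 xy vals c' by auto
  next
    case 3
    have "?a (x, y)" "?a (x, y + 1)" "\<not> ?a (x, y - 1)" "?a (x - 1, y)" "\<not> ?a (x + 1, y)"
      by (rule inside outside; use 3 xy \<open>0 \<le> x\<close> assms(2) in arith)+
    then show ?thesis unfolding eca_a b using 3 xy vals c' by auto
  next
    case 4
    have "?a (x, y)" "\<not> ?a (x, y + 1)" "\<not> ?a (x, y - 1)" "?a (x - 1, y)"
      by (rule inside outside; use 4 xy \<open>0 \<le> x\<close> assms(2) in arith)+
    moreover have "?a (x + 1, y)" using 4 tip a[of "x + 1" y] by simp
    ultimately
    show ?thesis unfolding eca_a b using 4 xy vals tip' by auto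
  next
    case 5
    have "\<not> ?a (x, y)" "\<not> ?a (x, y + 1)" "?a (x, y - 1)" "?a (x - 1, y)" "\<not> ?a (x + 1, y)"
      by (rule inside outside; use 5 xy \<open>0 \<le> x\<close> assms(2) in arith)+
    then show ?thesis unfolding eca_a b using 5 xy vals c' by auto
  next
    case 6
    have "\<not> ?a (x, y)" "?a (x, y + 1)" "\<not> ?a (x, y - 1)" "?a (x - 1, y)" "\<not> ?a (x + 1, y)"
      by (rule inside outside; use 6 xy \<open>0 \<le> x\<close> assms(2) in arith)+
    then show ?thesis unfolding eca_a b using 6 xy vals c' by auto
  next
    case 7
    have "\<not> ?a (x, y + 1)" "\<not> ?a (x, y - 1)" "?a (x - 1, y)"
      by (rule inside outside; use 7 xy \<open>0 \<le> x\<close> assms(2) in arith)+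
    moreover have "?a (x, y)" using 7 tip a[of x y] by simp
    ultimately have val: "?a (x, y)" "\<not> ?a (x, y + 1)" "\<not> ?a (x, y - 1)" "?a (x - 1, y)"
      by blast+
    \<comment> \<open>Within its own orbit the tip of the copy has at most a right neighbour; next
      to the ball it has a left one as well. No neighbour, one neighbour and an opposite pair all
      keep a live cell alive, so the contact changes nothing.\<close>
    have "?c (x - n, y)" using 7 tip by simp
    moreover have "\<not> ?c (x - n, y + 1)" "\<not> ?c (x - n, y - 1)"
      using 7 c[of x "y + 1"] c[of x "y - 1"] by auto
    moreover have "\<not> ?c (x - n - 1, y)"
      using 7 c[of "x - 1" y] by (auto simp: algebra_simps)
    ultimately have "orbit f (Suc t) (x - n, y)"
      unfolding orbit_Suc eca_def using vals by (cases "?c (x - n + 1, y)") auto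
    with val show ?thesis unfolding eca_a b using vals by (cases "?a (x + 1, y)") auto
  next
    case 8
    have near: "?a (u, v) \<longleftrightarrow> ?c (u - n, v)" if "\<bar>u - x\<bar> + \<bar>v - y\<bar> \<le> 1" for u v
      using a[OF that] that 8 by arith
    have "?a (x, y) = ?c (x - n, y)" "?a (x, y + 1) = ?c (x - n, y + 1)"
      "?a (x, y - 1) = ?c (x - n, y - 1)" "?a (x - 1, y) = ?c (x - n - 1, y)"
      "?a (x + 1, y) = ?c (x - n + 1, y)"
      using near[of x y] near[of x "y + 1"] near[of x "y - 1"] near[of "x - 1" y] near[of "x + 1" y]
      by (simp_all add: algebra_simps)
    then show ?thesis unfolding eca_a b using 8 \<open>0 \<le> x\<close> by (simp add: orbit_Suc eca_def)
  qed
qed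

section \<open>Parity pattern at dyadic times\<close>

text \<open>For even \<open>n\<close>, a cell of odd coordinate sum is alive and two opposite
  neighbours of it have both coordinates odd, so at most one opposite pair is alive and the cell
  survives. A cell of even sum in the ball has four live neighbours and becomes 1 whatever its
  state. At distance \<open>n\<close>, a site on an axis has one live neighbour, any other site two
  adjacent ones. The case \<open>n = 1\<close> is the seed.\<close>

lemma eca_parity_pattern:
  assumes f: "Tb_rule f"
    and supp: "\<And>x y. c (x, y) \<Longrightarrow> \<bar>x\<bar> + \<bar>y\<bar> < n"
    and one: "\<And>x y. \<bar>x\<bar> + \<bar>y\<bar> < n \<Longrightarrow> odd (x + y) \<Longrightarrow> c (x, y)"
    and zero: "\<And>x y. odd x \<Longrightarrow> odd y \<Longrightarrow> \<not> c (x, y)"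
    and "c (0, 0)" and n: "n = 1 \<or> even n" "0 < n"
  shows "eca f c (x, y) \<longleftrightarrow> \<bar>x\<bar> + \<bar>y\<bar> < n \<or> \<bar>x\<bar> + \<bar>y\<bar> = n \<and> (x = 0 \<or> y = 0)"
proof -
  note vals = Tb_rule_values[OF f]
  have eca: "eca f c (x, y) = f (c (x, y)) (c (x, y + 1)) (c (x, y - 1)) (c (x - 1, y)) (c (x + 1, y))"
    by (simp add: eca_def)
  have outside: "\<not> c (u, v)" if "\<bar>u\<bar> + \<bar>v\<bar> \<ge> n" for u v
    using supp[of u v] that by linarith
  have border: "c (u, v)" if "\<bar>u\<bar> + \<bar>v\<bar> = n - 1" for u v
  proof (cases "n = 1")
    case True
    then have "u = 0" "v = 0" using that by arith+
    then show ?thesis using \<open>c (0, 0)\<close> by simp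
  next
    case False
    have "\<bar>u\<bar> + \<bar>v\<bar> < n" using that by simp
    moreover have "odd (u + v)"
    proof -
      have "odd (\<bar>u\<bar> + \<bar>v\<bar>)" using that False n(1) by simp
      then show ?thesis by simp
    qed
    ultimately show ?thesis by (rule one)
  qed
  have rim: "x = n \<and> y = 0 \<or> x = - n \<and> y = 0 \<or> x = 0 \<and> y = n \<or> x = 0 \<and> y = - n
    \<or> x > 0 \<and> y > 0 \<and> x + y = n \<or> x > 0 \<and> y < 0 \<and> x - y = n
    \<or> x < 0 \<and> y > 0 \<and> y - x = n \<or> x < 0 \<and> y < 0 \<and> - x - y = n \<or> \<bar>x\<bar> + \<bar>y\<bar> > n"
    if "\<not> \<bar>x\<bar> + \<bar>y\<bar> < n"
    using that by (cases x "0 :: int" rule: linorder_cases; cases y "0 :: int" rule: linorder_cases) auto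
  show ?thesis
  proof (cases "\<bar>x\<bar> + \<bar>y\<bar> < n")
    case inside: True
    show ?thesis
    proof (cases "n = 1")
      case True
      with inside have "x = 0" "y = 0" by arith+
      with True have "\<not> c (x, y + 1)" "\<not> c (x, y - 1)" "\<not> c (x - 1, y)" "\<not> c (x + 1, y)"
        by (intro outside; simp)+
      then show ?thesis unfolding eca using True \<open>x = 0\<close> \<open>y = 0\<close> \<open>c (0, 0)\<close> vals by simp
    next
      case False
      then have "even n" using n(1) by simp
      consider "odd x" "even y" | "even x" "odd y" | "even x \<longleftrightarrow> even y" by blast
      then show ?thesis
      proof cases
        case 1
        with inside have "c (x, y)" "\<not> c (x, y + 1)" "\<not> c (x, y - 1)" by (simp_all add: one zero)
        then show ?thesis unfolding eca using inside vals
          by (cases "c (x - 1, y)"; cases "c (x + 1, y)") simp_all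
      next
        case 2
        with inside have "c (x, y)" "\<not> c (x - 1, y)" "\<not> c (x + 1, y)" by (simp_all add: one zero)
        then show ?thesis unfolding eca using inside vals
          by (cases "c (x, y - 1)"; cases "c (x, y + 1)") simp_all
      next
        case 3
        have "\<bar>x\<bar> + \<bar>y\<bar> \<noteq> n - 1"
        proof
          assume "\<bar>x\<bar> + \<bar>y\<bar> = n - 1"
          then have "odd (\<bar>x\<bar> + \<bar>y\<bar>)" using 3 inside \<open>even n\<close> by simp
          then show False using 3 inside \<open>even n\<close> by simp
        qed
        then have "\<bar>x\<bar> + \<bar>y\<bar> \<le> n - 2" using 3 inside \<open>even n\<close> by simp
        then have "c (x, y + 1)" "c (x, y - 1)" "c (x - 1, y)" "c (x + 1, y)"
          using 3 by (intro one; simp)+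
        then show ?thesis unfolding eca using inside vals by (cases "c (x, y)") simp_all
      qed
    qed
  next
    case False
    from rim[OF this] consider "x = n" "y = 0"
      | "x = - n" "y = 0"
      | "x = 0" "y = n"
      | "x = 0" "y = - n"
      | "x > 0" "y > 0" "x + y = n"
      | "x > 0" "y < 0" "x - y = n"
      | "x < 0" "y > 0" "y - x = n"
      | "x < 0" "y < 0" "- x - y = n"
      | "\<bar>x\<bar> + \<bar>y\<bar> > n"
      by (elim disjE) blast+
    then show ?thesis
    proof cases
      case 1
      then have "c (x - 1, y)" "\<not> c (x, y)" "\<not> c (x, y + 1)" "\<not> c (x, y - 1)" "\<not> c (x + 1, y)"
        using n by (simp_all add: border outside)
      then show ?thesis unfolding eca using 1 n vals by simp
    next
      case 2
      then have "c (x + 1, y)" "\<not> c (x, y)" "\<not> c (x, y + 1)" "\<not> c (x, y - 1)" "\<not> c (x - 1, y)"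
        using n by (simp_all add: border outside)
      then show ?thesis unfolding eca using 2 n vals by simp
    next
      case 3
      then have "c (x, y - 1)" "\<not> c (x, y)" "\<not> c (x, y + 1)" "\<not> c (x + 1, y)" "\<not> c (x - 1, y)"
        using n by (simp_all add: border outside)
      then show ?thesis unfolding eca using 3 n vals by simp
    next
      case 4
      then have "c (x, y + 1)" "\<not> c (x, y)" "\<not> c (x, y - 1)" "\<not> c (x + 1, y)" "\<not> c (x - 1, y)"
        using n by (simp_all add: border outside)
      then show ?thesis unfolding eca using 4 n vals by simp
    next
      case 5
      then have "\<not> c (x, y)" "\<not> c (x, y + 1)" "c (x, y - 1)" "c (x - 1, y)" "\<not> c (x + 1, y)"
        by (simp_all add: border outside)
      then show ?thesis unfolding eca using 5 vals by simp
    next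
      case 6
      then have "\<not> c (x, y)" "c (x, y + 1)" "\<not> c (x, y - 1)" "c (x - 1, y)" "\<not> c (x + 1, y)"
        by (simp_all add: border outside)
      then show ?thesis unfolding eca using 6 vals by simp
    next
      case 7
      then have "\<not> c (x, y)" "\<not> c (x, y + 1)" "c (x, y - 1)" "\<not> c (x - 1, y)" "c (x + 1, y)"
        by (simp_all add: border outside)
      then show ?thesis unfolding eca using 7 vals by simp
    next
      case 8
      then have "\<not> c (x, y)" "c (x, y + 1)" "\<not> c (x, y - 1)" "\<not> c (x - 1, y)" "c (x + 1, y)"
        by (simp_all add: border outside)
      then show ?thesis unfolding eca using 8 vals by simp
    next
      case 9
      then have "\<not> c (x, y)" "\<not> c (x, y + 1)" "\<not> c (x, y - 1)" "\<not> c (x - 1, y)" "\<not> c (x + 1, y)"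
        by (intro outside; arith)+
      then show ?thesis unfolding eca using 9 vals by simp
    qed
  qed
qed

text \<open>Even shifts preserve the parity of both coordinates. A site of odd sum is off the
  diagonals, so it lies strictly inside one of the four cones, where the open ball of radius
  \<open>2 * n\<close> is contained in the open ball of radius \<open>n\<close> around that cone's
  centre.\<close>

lemma four_copies_parity:
  assumes one: "\<And>x y. \<bar>x\<bar> + \<bar>y\<bar> < n \<Longrightarrow> odd (x + y) \<Longrightarrow> c (x, y)"
    and zero: "\<And>x y. odd x \<Longrightarrow> odd y \<Longrightarrow> \<not> c (x, y)"
    and "even n"
  shows "\<bar>x\<bar> + \<bar>y\<bar> < 2 * n \<Longrightarrow> odd (x + y) \<Longrightarrow> ball_with_copies n 0 c (x, y)"
    and "odd x \<Longrightarrow> odd y \<Longrightarrow> \<not> ball_with_copies n 0 c (x, y)"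
proof -
  show "\<not> ball_with_copies n 0 c (x, y)" if "odd x" "odd y"
  proof -
    have "x \<noteq> 0" using that(1) by auto
    then have "\<not> \<bar>x\<bar> + \<bar>y\<bar> \<le> 0" by arith
    then show ?thesis
      using zero[of "x - n" y] zero[of "x + n" y] zero[of x "y - n"] zero[of x "y + n"]
        that \<open>even n\<close> by (simp add: ball_with_copies_def)
  qed
  show "ball_with_copies n 0 c (x, y)" if "\<bar>x\<bar> + \<bar>y\<bar> < 2 * n" "odd (x + y)"
  proof -
    have "x \<noteq> y" "x \<noteq> - y" using that(2) by auto
    then consider "\<bar>y\<bar> < x" | "\<bar>y\<bar> < - x" | "\<bar>x\<bar> < y" | "\<bar>x\<bar> < - y" by arith
    then have "\<bar>x - n\<bar> + \<bar>y\<bar> < n \<or> \<bar>x + n\<bar> + \<bar>y\<bar> < n \<or> \<bar>x\<bar> + \<bar>y - n\<bar> < n \<or> \<bar>x\<bar> + \<bar>y + n\<bar> < n"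
    proof cases
      case 1
      then have "\<bar>x - n\<bar> + \<bar>y\<bar> < n" using that(1) by arith
      then show ?thesis by blast
    next
      case 2
      then have "\<bar>x + n\<bar> + \<bar>y\<bar> < n" using that(1) by arith
      then show ?thesis by blast
    next
      case 3
      then have "\<bar>x\<bar> + \<bar>y - n\<bar> < n" using that(1) by arith
      then show ?thesis by blast
    next
      case 4
      then have "\<bar>x\<bar> + \<bar>y + n\<bar> < n" using that(1) by arith
      then show ?thesis by blast
    qed
    then show ?thesis
      using one[of "x - n" y] one[of "x + n" y] one[of x "y - n"] one[of x "y + n"]
        that(2) \<open>even n\<close> unfolding ball_with_copies_def by auto
  qed
qed

text \<open>The parity pattern gives \<open>t = 0\<close>, and each further step removes one layer.
  The bound on \<open>t\<close> keeps the radius at least 1 before every erosion and allows it to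
  end at 0.\<close>

lemma orbit_dyadic_step:
  assumes f: "Tb_rule f"
    and one: "\<And>x y. \<bar>x\<bar> + \<bar>y\<bar> < 2 ^ k \<Longrightarrow> odd (x + y) \<Longrightarrow> orbit f (2 ^ k - 1) (x, y)"
    and zero: "\<And>x y. odd x \<Longrightarrow> odd y \<Longrightarrow> \<not> orbit f (2 ^ k - 1) (x, y)"
    and "orbit f (2 ^ k - 1) (0, 0)"
  shows "t < 2 ^ k \<Longrightarrow>
    orbit f (2 ^ k + t) = ball_with_copies (2 ^ k) (2 ^ k - 1 - int t) (orbit f t)"
proof (induction t)
  case 0
  have "\<bar>x\<bar> + \<bar>y\<bar> < 2 ^ k" if "orbit f (2 ^ k - 1) (x, y)" for x y
    using orbit_support[OF f that] by (simp add: of_nat_diff)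
  moreover have "(2 :: int) ^ k = 1 \<or> even ((2 :: int) ^ k)" by (cases k) auto
  ultimately have step: "eca f (orbit f (2 ^ k - 1)) (x, y) \<longleftrightarrow>
      \<bar>x\<bar> + \<bar>y\<bar> < 2 ^ k \<or> \<bar>x\<bar> + \<bar>y\<bar> = 2 ^ k \<and> (x = 0 \<or> y = 0)" for x y
    using eca_parity_pattern[OF f, of "orbit f (2 ^ k - 1)" "2 ^ k"] one zero assms(4)
    by (simp add: zero_less_power)
  have "orbit f (2 ^ k + 0) = eca f (orbit f (2 ^ k - 1))"
    using orbit_Suc[of f "2 ^ k - 1"] by simp
  also have "\<dots> = ball_with_copies (2 ^ k) (2 ^ k - 1 - int 0) (orbit f 0)"
  proof
    fix p :: "int \<times> int"
    obtain x y where p: "p = (x, y)" by fastforce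
    have pos: "(0 :: int) < 2 ^ k" by simp
    then have "\<bar>x\<bar> + \<bar>y\<bar> = 2 ^ k \<and> (x = 0 \<or> y = 0) \<longleftrightarrow>
      x - 2 ^ k = 0 \<and> y = 0 \<or> x + 2 ^ k = 0 \<and> y = 0 \<or> x = 0 \<and> y - 2 ^ k = 0 \<or> x = 0 \<and> y + 2 ^ k = 0"
      by arith
    then show "eca f (orbit f (2 ^ k - 1)) p = ball_with_copies (2 ^ k) (2 ^ k - 1 - int 0) (orbit f 0) p"
      unfolding p step ball_with_copies_def by (simp add: orbit_0 seed_def zle_diff1_eq)
  qed
  finally show ?case .
next
  case (Suc t)
  have "1 \<le> (2 :: int) ^ k - 1 - int t"
  proof -
    have "int (Suc t) < int (2 ^ k)" using Suc.prems by (simp only: of_nat_less_iff)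
    then show ?thesis by simp
  qed
  from eca_ball_with_copies[OF f this, of "2 ^ k"] Suc show ?case
    by (simp add: orbit_Suc algebra_simps)
qed

lemma orbit_dyadic_parity:
  assumes f: "Tb_rule f"
  shows "(\<forall>x y. \<bar>x\<bar> + \<bar>y\<bar> < 2 ^ k \<longrightarrow> odd (x + y) \<longrightarrow> orbit f (2 ^ k - 1) (x, y)) \<and>
    (\<forall>x y. odd x \<longrightarrow> odd y \<longrightarrow> \<not> orbit f (2 ^ k - 1) (x, y)) \<and> orbit f (2 ^ k - 1) (0, 0)"
proof (induction k)
  case 0
  then show ?case by (auto simp: orbit_0 seed_def)
next
  case (Suc k)
  let ?c = "orbit f (2 ^ k - 1)"
  have "orbit f (2 ^ k + (2 ^ k - 1)) = ball_with_copies (2 ^ k) (2 ^ k - 1 - int (2 ^ k - 1)) ?c"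
    using orbit_dyadic_step[OF f, of k "2 ^ k - 1"] Suc by simp
  moreover have "2 ^ k + (2 ^ k - 1) = 2 ^ Suc k - (1 :: nat)" by simp
  moreover have "2 ^ k - 1 - int (2 ^ k - 1) = 0" by (simp add: of_nat_diff)
  ultimately have eq: "orbit f (2 ^ Suc k - 1) = ball_with_copies (2 ^ k) 0 ?c" by metis
  show ?case
  proof (cases k)
    case 0
    \<comment> \<open>The shift by 1 is odd, so \<open>four_copies_parity\<close> does not apply;
      the configuration is the cross of five cells and is checked directly.\<close>
    have one: "ball_with_copies 1 0 seed (x, y)" if "\<bar>x\<bar> + \<bar>y\<bar> < 2" "odd (x + y)" for x y
    proof -
      have "x \<noteq> 0 \<or> y \<noteq> 0" using that(2) by auto
      with that(1) consider "x = 1" "y = 0" | "x = - 1" "y = 0" | "x = 0" "y = 1" | "x = 0" "y = - 1"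
        by arith
      then show ?thesis unfolding ball_with_copies_def seed_def by cases simp_all
    qed
    have "\<not> ball_with_copies 1 0 seed (x, y)" if "odd x" "odd y" for x y
    proof -
      have "x \<noteq> 0" "y \<noteq> 0" using that by auto
      moreover from this have "\<not> \<bar>x\<bar> + \<bar>y\<bar> \<le> 0" by arith
      ultimately show ?thesis by (simp add: ball_with_copies_def seed_def)
    qed
    with one show ?thesis unfolding eq by (simp add: 0 orbit_0) (simp add: ball_with_copies_def)
  next
    case (Suc j)
    have "even ((2 :: int) ^ k)" using Suc by simp
    from four_copies_parity[OF _ _ this, of ?c] \<open>_ \<and> _\<close>
    show ?thesis unfolding eq by (auto simp: ball_with_copies_def)
  qed
qed

lemma orbit_eq_ball_with_copies:
  assumes "Tb_rule f" "t < 2 ^ k"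
  shows "orbit f (2 ^ k + t) = ball_with_copies (2 ^ k) (2 ^ k - 1 - int t) (orbit f t)"
  using orbit_dyadic_step[OF assms(1) _ _ _ assms(2)] orbit_dyadic_parity[OF assms(1), of k] by blast

subsection \<open>Counting nonzero states\<close>

lemma finite_orbit:
  assumes "Tb_rule f"
  shows "finite {p. orbit f t p}"
proof (rule finite_subset)
  show "{p. orbit f t p} \<subseteq> {- int t..int t} \<times> {- int t..int t}"
    using orbit_support[OF assms] by fastforce
qed simp

lemma num_b_0: "num_b f 0 = 0"
  by (simp add: num_b_def)

text \<open>The infinite sum has finite support and counts live cells. The count with index
  \<open>Suc t\<close> belongs to time \<open>t\<close>.\<close>

lemma num_b_Suc:
  assumes "Tb_rule f"
  shows "num_b f (Suc t) = card {p. orbit f t p}"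
proof -
  have "(\<Sum>\<^sub>\<infinity>p. of_bool (orbit f t p) :: nat) = (\<Sum>\<^sub>\<infinity>p\<in>{p. orbit f t p}. 1)"
    by (rule infsum_cong_neutral) auto
  also have "\<dots> = card {p. orbit f t p}"
    using finite_orbit[OF assms] by simp
  finally show ?thesis by (simp add: num_b_def orbit_def)
qed

text \<open>Counting by columns: from \<open>m\<close> to \<open>Suc m\<close> each of the
  \<open>2 * m + 1\<close> columns gains two cells, and two columns of one cell are new.\<close>

lemma card_l1_ball: "card {(x, y). \<bar>x\<bar> + \<bar>y\<bar> \<le> int m} = 2 * m\<^sup>2 + 2 * m + 1"
proof -
  have "{(x, y). \<bar>x\<bar> + \<bar>y\<bar> \<le> int m} = (SIGMA x:{- int m..int m}. {- (int m - \<bar>x\<bar>)..int m - \<bar>x\<bar>})"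
    by auto
  then have "card {(x, y). \<bar>x\<bar> + \<bar>y\<bar> \<le> int m} = (\<Sum>x = - int m..int m. nat (2 * (int m - \<bar>x\<bar>) + 1))"
    by (simp add: card_SigmaI algebra_simps)
  also have "int \<dots> = (\<Sum>x = - int m..int m. 2 * (int m - \<bar>x\<bar>) + 1)"
    unfolding of_nat_sum by (rule sum.cong) auto
  also have "\<dots> = 2 * (int m)\<^sup>2 + 2 * int m + 1"
  proof (induction m)
    case (Suc m)
    have "{- int (Suc m)..int (Suc m)} = insert (- int (Suc m)) (insert (int (Suc m)) {- int m..int m})"
      by auto
    then have "(\<Sum>x = - int (Suc m)..int (Suc m). 2 * (int (Suc m) - \<bar>x\<bar>) + 1)
      = 2 + (\<Sum>x = - int m..int m. 2 * (int (Suc m) - \<bar>x\<bar>) + 1)"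
      by simp
    also have "(\<Sum>x = - int m..int m. 2 * (int (Suc m) - \<bar>x\<bar>) + 1)
      = (\<Sum>x = - int m..int m. (2 * (int m - \<bar>x\<bar>) + 1) + 2)"
      by (rule sum.cong) auto
    also have "\<dots> = (2 * (int m)\<^sup>2 + 2 * int m + 1) + 2 * (2 * int m + 1)"
      by (subst sum.distrib) (simp only: Suc.IH, simp)
    finally show ?case by (simp add: power2_eq_square algebra_simps)
  qed simp
  also have "\<dots> = int (2 * m\<^sup>2 + 2 * m + 1)" by simp
  finally show ?thesis by (simp only: of_nat_eq_iff)
qed

text \<open>The centres of the copies are at \<open>l1\<close> distance \<open>2 * n\<close> from
  each other and \<open>n\<close> from the origin, so the triangle inequality makes the five pieces
  disjoint.\<close>

lemma card_ball_with_copies: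
  assumes fin: "finite {p. c p}"
    and supp: "\<And>x y. c (x, y) \<Longrightarrow> \<bar>x\<bar> + \<bar>y\<bar> + int m < n"
    and supp': "\<And>x y. c (x, y) \<Longrightarrow> \<bar>x\<bar> + \<bar>y\<bar> < n"
  shows "card {p. ball_with_copies n (int m) c p} = 4 * card {p. c p} + 2 * m\<^sup>2 + 2 * m + 1"
proof -
  define copy where "copy a b = (\<lambda>(x, y). (x + a, y + b)) ` {p. c p}" for a b :: int
  have mem: "(x, y) \<in> copy a b \<longleftrightarrow> c (x - a, y - b)" for x y a b
  proof
    assume "c (x - a, y - b)"
    then show "(x, y) \<in> copy a b" unfolding copy_def by (intro image_eqI[of _ _ "(x - a, y - b)"]) auto
  qed (auto simp: copy_def)
  have card: "card (copy a b) = card {p. c p}" for a b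
    unfolding copy_def by (rule card_image) (auto simp: inj_on_def)
  have fin: "finite (copy a b)" for a b unfolding copy_def using fin by simp
  have far: "\<bar>x - a\<bar> + \<bar>y - b\<bar> < n" "\<bar>x - a\<bar> + \<bar>y - b\<bar> + int m < n"
    if "(x, y) \<in> copy a b" for x y a b
    using supp supp' that by (auto simp: mem)
  have copies: "copy a b \<inter> copy a' b' = {}" if "2 * n \<le> \<bar>a - a'\<bar> + \<bar>b - b'\<bar>" for a b a' b'
  proof -
    have False if "(x, y) \<in> copy a b" "(x, y) \<in> copy a' b'" for x y
      using far(1)[OF that(1)] far(1)[OF that(2)] \<open>2 * n \<le> _\<close> by arith
    then show ?thesis by fastforce
  qed
  let ?B = "{(x, y). \<bar>x\<bar> + \<bar>y\<bar> \<le> int m}"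
  have ball: "?B \<inter> copy a b = {}" if "n \<le> \<bar>a\<bar> + \<bar>b\<bar>" for a b
  proof -
    have False if "\<bar>x\<bar> + \<bar>y\<bar> \<le> int m" "(x, y) \<in> copy a b" for x y
      using far(2)[OF that(2)] that(1) \<open>n \<le> _\<close> by arith
    then show ?thesis by fastforce
  qed
  have finB: "finite ?B"
    by (rule finite_subset[of _ "{- int m..int m} \<times> {- int m..int m}"]) auto
  have "{p. ball_with_copies n (int m) c p} = ?B \<union> (copy n 0 \<union> (copy (- n) 0 \<union> (copy 0 n \<union> copy 0 (- n))))"
    by (auto simp: ball_with_copies_def mem)
  also have "card \<dots> = card ?B + (card (copy n 0) + (card (copy (- n) 0) + (card (copy 0 n) + card (copy 0 (- n)))))"
    using fin finB by (simp add: card_Un_disjoint Int_Un_distrib copies ball)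
  finally show ?thesis by (simp add: card card_l1_ball)
qed

text \<open>With \<open>s = Suc t\<close> the radius \<open>2 ^ k - 1 - t\<close> of the ball is
  \<open>2 ^ k - s\<close>. The value \<open>s = 2 ^ k\<close>, with radius 0, is included and
  drives the recursion at powers of two.\<close>

lemma num_b_add:
  assumes f: "Tb_rule f" and "1 \<le> s" "s \<le> 2 ^ k"
  shows "num_b f (2 ^ k + s) = 4 * num_b f s + 2 * (2 ^ k - s)\<^sup>2 + 2 * (2 ^ k - s) + 1"
proof -
  obtain t where s: "s = Suc t" using assms(2) by (cases s) auto
  have t: "t < 2 ^ k" using assms(3) s by simp
  have int: "int (2 ^ k - s) = 2 ^ k - 1 - int t" using assms(3) by (simp add: s of_nat_diff)
  have supp: "\<bar>x\<bar> + \<bar>y\<bar> + int (2 ^ k - s) < 2 ^ k \<and> \<bar>x\<bar> + \<bar>y\<bar> < 2 ^ k" if "orbit f t (x, y)" for x y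
    using orbit_support[OF f that] int by linarith
  have "num_b f (2 ^ k + s) = card {p. orbit f (2 ^ k + t) p}"
    using num_b_Suc[OF f, of "2 ^ k + t"] by (simp add: s)
  also have "\<dots> = card {p. ball_with_copies (2 ^ k) (int (2 ^ k - s)) (orbit f t) p}"
    by (simp add: orbit_eq_ball_with_copies[OF f t] int)
  also have "\<dots> = 4 * card {p. orbit f t p} + 2 * (2 ^ k - s)\<^sup>2 + 2 * (2 ^ k - s) + 1"
    by (rule card_ball_with_copies[OF finite_orbit[OF f]]) (use supp in auto)
  finally show ?thesis using num_b_Suc[OF f, of t] by (simp add: s)
qed

lemma num_b_1:
  assumes "Tb_rule f"
  shows "num_b f 1 = 1"
proof -
  have "{p. orbit f 0 p} = {(0, 0)}" by (auto simp: orbit_0 seed_def)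
  then show ?thesis using num_b_Suc[OF assms, of 0] by simp
qed

lemma num_b_power_2:
  assumes "Tb_rule f"
  shows "3 * num_b f (2 ^ k) + 1 = 4 ^ Suc k"
proof (induction k)
  case 0
  show ?case using num_b_1[OF assms] by simp
next
  case (Suc k)
  have "num_b f (2 ^ Suc k) = 4 * num_b f (2 ^ k) + 1"
    using num_b_add[OF assms, of "2 ^ k" k] by (simp add: mult_2)
  with Suc show ?case by simp
qed

text \<open>The quadratic term in \<open>2 ^ k - s\<close> is what makes the bound inductive: passing from \<open>2 ^ k\<close> to
  \<open>2 ^ Suc k\<close> replaces a coefficient \<open>a\<close> of it by \<open>4 * a - 6\<close>, whose fixed point is 2.\<close>

lemma num_b_bound:
  assumes f: "Tb_rule f" and "1 \<le> s" "s \<le> 2 ^ k"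
  shows "3 * num_b f s + 1 + 2 * (2 ^ k - s)\<^sup>2 + 2 * (2 ^ k - s) \<le> 4 ^ Suc k"
  using assms(2,3)
proof (induction k arbitrary: s)
  case 0
  then show ?case using num_b_1[OF f] by simp
next
  case (Suc k)
  show ?case
  proof (cases "s \<le> 2 ^ k")
    case True
    define r where "r = 2 ^ k - s"
    have r: "2 ^ Suc k - s = 2 ^ k + r" using True by (simp add: r_def)
    have "r + 1 \<le> 2 ^ k" using True Suc.prems(1) by (simp add: r_def)
    then have le: "r * 2 ^ k + 2 ^ k \<le> 2 ^ k * 2 ^ k"
      using mult_le_mono1[of "r + 1" "2 ^ k" "2 ^ k"] by simp
    have "3 * num_b f s + 1 + 2 * (2 ^ Suc k - s)\<^sup>2 + 2 * (2 ^ Suc k - s)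
      = (3 * num_b f s + 1 + 2 * r\<^sup>2 + 2 * r) + 2 * (2 ^ k * 2 ^ k) + 4 * (r * 2 ^ k) + 2 * 2 ^ k"
      unfolding r by (simp add: power2_eq_square algebra_simps)
    also have "\<dots> \<le> 4 ^ Suc k + 6 * (2 ^ k * 2 ^ k)"
      using Suc.IH[OF Suc.prems(1) True] le unfolding r_def[symmetric] by linarith
    also have "\<dots> \<le> 4 ^ Suc (Suc k)"
      by (simp flip: power_mult_distrib)
    finally show ?thesis .
  next
    case False
    \<comment> \<open>Here the recursion makes the left-hand side exactly four times that of the
      induction hypothesis for \<open>s'\<close>.\<close>
    define s' where "s' = s - 2 ^ k"
    have s: "s = 2 ^ k + s'" "1 \<le> s'" "s' \<le> 2 ^ k" using False Suc.prems(2) by (auto simp: s'_def)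
    have "2 ^ Suc k - s = 2 ^ k - s'" using s by simp
    then show ?thesis
      using num_b_add[OF f s(2,3)] Suc.IH[OF s(2,3)] unfolding s(1) by simp
  qed
qed

lemma num_b_le:
  assumes "Tb_rule f" "s \<le> 2 ^ k"
  shows "num_b f s \<le> num_b f (2 ^ k)"
proof (cases "s = 0")
  case False
  then show ?thesis using num_b_bound[OF assms(1) _ assms(2)] num_b_power_2[OF assms(1), of k] by simp
qed (simp add: num_b_0)

subsection \<open>Binary expansions and the limit\<close>

text \<open>For \<open>n = 0\<close> this is the integer at which \<open>G_approx f k\<close>
  evaluates \<open>num_b\<close>; larger \<open>n\<close> strips the leading digits.\<close>

definition digit_tail :: "(nat \<Rightarrow> nat) \<Rightarrow> nat \<Rightarrow> nat \<Rightarrow> nat" where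
  "digit_tail d k n = (\<Sum>j=n..k. d j * 2 ^ (k - j))"

text \<open>The separate value at \<open>s = 0\<close> lets \<open>num_b_layer\<close> hold there
  too, since \<open>num_b f 0 = 0\<close>.\<close>

definition layer :: "local_rule \<Rightarrow> nat \<Rightarrow> nat \<Rightarrow> nat" where
  "layer f m s = (if s = 0 then num_b f (2 ^ m) else 2 * (2 ^ m - s)\<^sup>2 + 2 * (2 ^ m - s) + 1)"

lemma num_b_layer:
  assumes "Tb_rule f" "s < 2 ^ m"
  shows "num_b f (2 ^ m + s) = layer f m s + 4 * num_b f s"
  using num_b_add[OF assms(1), of s m] assms(2) by (auto simp: layer_def num_b_0)

lemma digit_tail_Suc:
  "n \<le> k \<Longrightarrow> digit_tail d k n = d n * 2 ^ (k - n) + digit_tail d k (Suc n)"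
  by (simp add: digit_tail_def sum.atLeast_Suc_atMost)

lemma digit_tail_less:
  assumes "\<And>i. d i \<in> {0, 1}" "n \<le> Suc k"
  shows "digit_tail d k n < 2 ^ (Suc k - n)"
  using assms(2)
proof (induction rule: inc_induct)
  case base
  show ?case by (simp add: digit_tail_def)
next
  case (step n)
  have "d n \<le> 1" using assms(1)[of n] by auto
  then have "d n * 2 ^ (k - n) \<le> 2 ^ (k - n)" by simp
  moreover have "digit_tail d k n = d n * 2 ^ (k - n) + digit_tail d k (Suc n)"
    using step by (intro digit_tail_Suc) simp
  moreover have "(2 :: nat) ^ (Suc k - n) = 2 * 2 ^ (k - n)"
    using step by (simp add: Suc_diff_le)
  ultimately show ?case using step.IH unfolding diff_Suc_Suc by linarith
qed

text \<open>Digits are stripped from the front: a 0 changes nothing, and a 1 splits off a layer by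
  \<open>num_b_layer\<close> and multiplies all that follows by 4.\<close>

lemma num_b_digit_tail:
  assumes f: "Tb_rule f" and d: "\<And>i. d i \<in> {0, 1}" and "n \<le> Suc k"
  shows "num_b f (digit_tail d k 0) =
    (\<Sum>i<n. d i * 4 ^ (\<Sum>j<i. d j) * layer f (k - i) (digit_tail d k (Suc i)))
    + 4 ^ (\<Sum>j<n. d j) * num_b f (digit_tail d k n)"
  using assms(3)
proof (induction n)
  case (Suc n)
  have less: "digit_tail d k (Suc n) < 2 ^ (k - n)"
    using digit_tail_less[of d "Suc n" k] d Suc.prems by simp
  have tail: "digit_tail d k n = d n * 2 ^ (k - n) + digit_tail d k (Suc n)"
    using Suc.prems by (intro digit_tail_Suc) simp
  consider "d n = 0" | "d n = 1" using d[of n] by auto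
  then show ?case
  proof cases
    case 1
    then show ?thesis using Suc tail by simp
  next
    case 2
    then show ?thesis using Suc tail num_b_layer[OF f less] by (simp add: algebra_simps)
  qed
qed simp

lemma real_num_b_power_2:
  assumes "Tb_rule f"
  shows "real (num_b f (2 ^ k)) = (4 * 4 ^ k - 1) / 3"
proof -
  have "real (3 * num_b f (2 ^ k) + 1) = real (4 ^ Suc k)"
    by (simp only: num_b_power_2[OF assms])
  then show ?thesis by simp
qed

text \<open>Bounding the denominator below by \<open>4 ^ k\<close> and dropping the
  \<open>- 1\<close> in the numerator gives the constant 16/3, rounded up to 6.\<close>

lemma num_b_power_2_ratio_le:
  assumes f: "Tb_rule f" and "n \<le> Suc k"
  shows "real (num_b f (2 ^ (Suc k - n))) / real (num_b f (2 ^ k)) \<le> 6 / 4 ^ n"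
proof -
  have "(4 :: real) ^ (Suc k - n) * 4 ^ n = 4 ^ Suc k"
    using assms(2) by (simp flip: power_add)
  then have "(4 * 4 ^ (Suc k - n) / 3) / 4 ^ k = (16 / 3) / (4 ^ n :: real)"
    by (simp add: field_simps)
  moreover have "real (num_b f (2 ^ (Suc k - n))) / real (num_b f (2 ^ k))
      \<le> (4 * 4 ^ (Suc k - n) / 3) / 4 ^ k"
    unfolding real_num_b_power_2[OF f] by (rule frac_le) simp_all
  moreover have "(16 / 3) / (4 ^ n :: real) \<le> 6 / 4 ^ n" by (rule divide_right_mono) simp_all
  ultimately show ?thesis by linarith
qed

lemma sum_digits_plus_zeros:
  fixes d :: "nat \<Rightarrow> nat"
  assumes "\<And>i. d i \<in> {0, 1}"
  shows "(\<Sum>j<n. d j) + card {j\<in>{..<n}. d j = 0} = n"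
proof -
  have "card {j\<in>{..<n}. d j = 0} = (\<Sum>j\<in>{j\<in>{..<n}. d j = 0}. 1)" by simp
  also have "\<dots> = (\<Sum>j<n. if d j = 0 then 1 else 0)" by (rule sum.inter_filter) simp
  finally have "(\<Sum>j<n. d j) + card {j\<in>{..<n}. d j = 0} = (\<Sum>j<n. d j + (if d j = 0 then 1 else 0))"
    by (simp only: sum.distrib)
  moreover have "d j + (if d j = 0 then 1 else 0) = 1" for j using assms[of j] by auto
  ultimately show ?thesis by simp
qed

text \<open>The quotient is \<open>1 / 4\<close> to the number of zeros among the first
  \<open>n\<close> digits, and that number is unbounded.\<close>

lemma tendsto_power_4_sum_digits:
  fixes d :: "nat \<Rightarrow> nat"
  assumes d: "\<And>i. d i \<in> {0, 1}" and "infinite {j. d j = 0}"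
  shows "(\<lambda>n. (4 :: real) ^ (\<Sum>j<n. d j) / 4 ^ n) \<longlonglongrightarrow> 0"
proof -
  define z where "z n = card {j\<in>{..<n}. d j = 0}" for n
  have "(4 :: real) ^ (\<Sum>j<n. d j) / 4 ^ n = (1 / 4) ^ z n" for n
  proof -
    have "(\<Sum>j<n. d j) + z n = n" unfolding z_def by (rule sum_digits_plus_zeros) (rule d)
    then have "(4 :: real) ^ n = 4 ^ (\<Sum>j<n. d j) * 4 ^ z n" by (metis power_add)
    then have "(4 :: real) ^ (\<Sum>j<n. d j) / 4 ^ n = 4 ^ (\<Sum>j<n. d j) / (4 ^ (\<Sum>j<n. d j) * 4 ^ z n)"
      by (rule arg_cong)
    then show ?thesis by (simp add: power_one_over)
  qed
  moreover have "filterlim z at_top sequentially"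
    unfolding filterlim_at_top
  proof
    fix b
    obtain F where F: "finite F" "card F = b" "F \<subseteq> {j. d j = 0}"
      using infinite_arbitrarily_large[OF assms(2)] by blast
    obtain m where m: "\<And>j. j \<in> F \<Longrightarrow> j < m"
      using F(1) by (meson finite_nat_set_iff_bounded)
    have "b \<le> z n" if "m \<le> n" for n
      unfolding z_def F(2)[symmetric] using F(3) m that by (intro card_mono) force+
    then show "\<forall>\<^sub>F n in sequentially. b \<le> z n" by (auto simp: eventually_at_top_linorder)
  qed
  moreover have "(\<lambda>n. (1 / 4 :: real) ^ n) \<longlonglongrightarrow> 0" by (rule LIMSEQ_power_zero) simp
  ultimately show ?thesis by (simp add: filterlim_compose)
qed

text \<open>If all digits after a last zero were 1, a carry would give a second expansion, so the
  chosen one would have to be finite. With no zero at all the sum would be 2.\<close>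

lemma chosen_expansion_infinite_zeros:
  assumes d: "is_chosen_expansion d x" and "x \<le> 1"
  shows "infinite {j. d j = 0}"
proof
  assume fin: "finite {j. d j = 0}"
  have bin: "is_binary_expansion d x" using d by (simp add: is_chosen_expansion_def)
  then have d01: "\<And>i. d i \<in> {0, 1}" and sums: "(\<lambda>i. real (d i) / 2 ^ i) sums x"
    by (auto simp: is_binary_expansion_def)
  have "{j. d j = 0} \<noteq> {}"
  proof
    assume "{j. d j = 0} = {}"
    then have "d i = 1" for i using d01[of i] by blast
    then have "(\<lambda>i. real (d i) / 2 ^ i) = (\<lambda>i. (1 / 2) ^ i)" by (simp add: power_one_over)
    moreover have "(\<lambda>i. (1 / 2 :: real) ^ i) sums 2" using geometric_sums[of "1 / 2 :: real"] by simp
    ultimately have "x = 2" using sums sums_unique2 by metis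
    then show False using assms(2) by simp
  qed
  define m where "m = Max {j. d j = 0}"
  have m: "d m = 0" using Max_in[OF fin] \<open>_ \<noteq> {}\<close> by (simp add: m_def)
  have one: "d i = 1" if "m < i" for i
    using Max_ge[OF fin, of i] that d01[of i] by (auto simp: m_def)
  \<comment> \<open>The carry: the gain \<open>1 / 2 ^ m\<close> at the last zero \<open>m\<close>
    cancels the geometric tail of ones.\<close>
  define e where "e i = (if i < m then d i else if i = m then 1 else 0)" for i
  let ?g = "\<lambda>i. (real (e i) - real (d i)) / 2 ^ i"
  have "(\<lambda>i. - (1 / 2 ^ Suc m) * (1 / 2) ^ i :: real) sums (- (1 / 2 ^ Suc m) * (1 / (1 - 1 / 2)))"
    by (intro sums_mult geometric_sums) simp
  moreover have "(\<lambda>i. - (1 / 2 ^ Suc m) * (1 / 2) ^ i) = (\<lambda>i. ?g (i + Suc m))"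
    using one by (auto simp: e_def power_add field_simps)
  moreover have "(\<Sum>i<Suc m. ?g i) = 1 / 2 ^ m" using m by (simp add: e_def)
  ultimately have "?g sums 0" using sums_iff_shift[of ?g "Suc m" "- 1 / 2 ^ m"] by simp
  from sums_add[OF this sums] have "(\<lambda>i. real (e i) / 2 ^ i) sums x"
    by (simp add: diff_divide_distrib)
  moreover have "e i \<in> {0, 1}" for i using d01[of i] by (auto simp: e_def)
  moreover have "e \<noteq> d" using m by (auto simp: e_def fun_eq_iff)
  ultimately have "finite {i. d i \<noteq> 0}"
    using d by (auto simp: is_chosen_expansion_def is_binary_expansion_def)
  with fin have "finite ({i. d i \<noteq> 0} \<union> {i. d i = 0})" by simp
  moreover have "{i. d i \<noteq> 0} \<union> {i. d i = 0} = UNIV" by auto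
  ultimately show False using infinite_UNIV_nat by metis
qed

text \<open>This exchanges the limits in \<open>k\<close> and \<open>n\<close>. For fixed
  \<open>n\<close>, \<open>g\<close> is eventually close to \<open>S n\<close> up to
  \<open>e n\<close>, so it is Cauchy, and passing to the limit bounds the distance from
  \<open>lim g\<close> to \<open>S n\<close> by \<open>e n\<close>.\<close>

lemma tendsto_of_truncations:
  fixes g :: "nat \<Rightarrow> real"
  assumes A: "\<And>n. (\<lambda>k. A k n) \<longlonglongrightarrow> S n" and e: "e \<longlonglongrightarrow> 0"
    and le: "\<And>n. \<forall>\<^sub>F k in sequentially. \<bar>g k - A k n\<bar> \<le> e n"
  shows "convergent g" "S \<longlonglongrightarrow> lim g"
proof -
  have "Cauchy g"
  proof (rule metric_CauchyI)
    fix r :: real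
    assume "0 < r"
    then have "\<forall>\<^sub>F n in sequentially. e n < r / 4"
      by (intro order_tendstoD(2)[OF e]) simp
    then obtain n where n: "e n < r / 4" by (auto simp: eventually_at_top_linorder)
    have "\<forall>\<^sub>F k in sequentially. dist (A k n) (S n) < r / 4"
      by (intro tendstoD[OF A]) (simp add: \<open>0 < r\<close>)
    with le[of n] have "\<forall>\<^sub>F k in sequentially. \<bar>g k - S n\<bar> < r / 2"
      by eventually_elim (use n in \<open>auto simp: dist_real_def abs_if split: if_splits\<close>)
    then obtain K where "\<And>k. k \<ge> K \<Longrightarrow> \<bar>g k - S n\<bar> < r / 2"
      by (auto simp: eventually_at_top_linorder)
    then have near: "\<bar>g k - S n\<bar> < r / 2" if "k \<ge> K" for k using that .
    have "dist (g k) (g l) < r" if "k \<ge> K" "l \<ge> K" for k l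
      using near[OF that(1)] near[OF that(2)] unfolding dist_real_def by linarith
    then show "\<exists>K. \<forall>k\<ge>K. \<forall>l\<ge>K. dist (g k) (g l) < r" by blast
  qed
  then show "convergent g" by (simp add: Cauchy_convergent_iff)
  then have g: "g \<longlonglongrightarrow> lim g" by (simp add: convergent_LIMSEQ_iff)
  have "\<bar>lim g - S n\<bar> \<le> e n" for n
    by (rule tendsto_upperbound[OF tendsto_rabs[OF tendsto_diff[OF g A[of n]]] le]) simp
  then have "(\<lambda>n. S n - lim g) \<longlonglongrightarrow> 0"
    by (intro Lim_null_comparison[OF always_eventually e]) (simp add: abs_minus_commute)
  then show "S \<longlonglongrightarrow> lim g" by (rule LIM_zero_cancel)
qed

section \<open>Limit of a single term of the series\<close>

text \<open>The partial products are 0 from the first digit 1 on, or constantly 1. Convergence must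
  be shown before the \<open>lim\<close> in \<open>inf_prod_from\<close> carries
  information.\<close>

lemma tendsto_inf_prod_from:
  fixes d :: "nat \<Rightarrow> nat"
  assumes d: "\<And>i. d i \<in> {0, 1}"
  shows "(\<lambda>n. \<Prod>j=m..n. 1 - real (d j)) \<longlonglongrightarrow> inf_prod_from m (\<lambda>j. 1 - real (d j))"
proof -
  have "convergent (\<lambda>n. \<Prod>j=m..n. 1 - real (d j))"
  proof (cases "\<exists>i\<ge>m. d i = 1")
    case True
    then obtain i where i: "m \<le> i" "d i = 1" by blast
    have "\<forall>\<^sub>F n in sequentially. (\<Prod>j=m..n. 1 - real (d j)) = 0"
      using eventually_ge_at_top[of i] by eventually_elim (use i in \<open>auto intro!: bexI[of _ i]\<close>)
    then show ?thesis using tendsto_eventually convergentI by metis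
  next
    case False
    then have "d j = 0" if "m \<le> j" for j using d[of j] that by auto
    then have "(\<lambda>n. \<Prod>j=m..n. 1 - real (d j)) = (\<lambda>n. 1)" by (auto intro!: prod.neutral)
    then show ?thesis by (simp add: convergent_const)
  qed
  then show ?thesis by (simp add: inf_prod_from_def convergent_LIMSEQ_iff)
qed

text \<open>This is how the product enters the formula: its truncation is the indicator of the
  exceptional case \<open>s = 0\<close> of \<open>layer\<close>.\<close>

lemma prod_digits_eq:
  fixes d :: "nat \<Rightarrow> nat"
  assumes d: "\<And>i. d i \<in> {0, 1}"
  shows "(\<Prod>j=m..k. 1 - real (d j)) = of_bool (digit_tail d k m = 0)"
proof (cases "digit_tail d k m = 0")
  case True
  then have "\<forall>j\<in>{m..k}. d j = 0" by (simp add: digit_tail_def)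
  then have "(\<Prod>j=m..k. 1 - real (d j)) = 1" by (intro prod.neutral) simp
  with True show ?thesis by simp
next
  case False
  then obtain j where "j \<in> {m..k}" "d j \<noteq> 0" by (auto simp: digit_tail_def)
  moreover from this have "d j = 1" using d[of j] by auto
  ultimately have "(\<Prod>j=m..k. 1 - real (d j)) = 0" by (intro prod_zero) auto
  with False show ?thesis by simp
qed

text \<open>The correction is the quadratic expression at \<open>s = 0\<close> minus
  \<open>(4 * 4 ^ m - 1) / 3\<close>.\<close>

lemma layer_real:
  assumes f: "Tb_rule f" and "s \<le> 2 ^ m"
  shows "real (layer f m s) = 2 * (2 ^ m - real s)\<^sup>2 + 2 * (2 ^ m - real s) + 1
    - of_bool (s = 0) * (2 / 3 * 4 ^ m + 2 * 2 ^ m + 4 / 3)"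
proof (cases "s = 0")
  case True
  have "((2 :: real) ^ m)\<^sup>2 = 4 ^ m" by (simp add: power2_eq_square flip: power_mult_distrib)
  with True show ?thesis
    by (simp add: layer_def real_num_b_power_2[OF f] field_simps)
next
  case False
  with assms(2) show ?thesis by (simp add: layer_def of_nat_diff)
qed

lemma real_digit_tail: "real (digit_tail d k n) = 2 ^ k * (\<Sum>j=n..k. real (d j) / 2 ^ j)"
  unfolding digit_tail_def of_nat_sum sum_distrib_left
  by (rule sum.cong) (simp_all only: of_nat_mult of_nat_power of_nat_numeral, simp add: power_diff)

text \<open>Complementing the digits turns the tail into \<open>2 ^ (k - i) - 1\<close> minus
  itself, whence the extra \<open>1 / 2 ^ k\<close>. Since \<open>d i = 1\<close>, the sum may start
  at \<open>i\<close>.\<close>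

lemma gap_eq:
  fixes d :: "nat \<Rightarrow> nat"
  assumes "d i = 1" "i \<le> k"
  shows "2 ^ (k - i) - real (digit_tail d k (Suc i))
    = 2 ^ k * ((\<Sum>j=i..k. (1 - real (d j)) / 2 ^ j) + 1 / 2 ^ k)"
proof -
  have geo: "(\<Sum>j=i..k. 1 / 2 ^ j) = 2 / 2 ^ i - 1 / (2 ^ k :: real)"
    using assms(2)
  proof (induction rule: dec_induct)
    case (step n)
    then have "(\<Sum>j=i..Suc n. 1 / 2 ^ j) = 2 / 2 ^ i - 1 / 2 ^ n + 1 / (2 ^ Suc n :: real)" by simp
    then show ?case by simp
  qed simp
  have "(\<Sum>j=i..k. (1 - real (d j)) / 2 ^ j) = (\<Sum>j=i..k. 1 / 2 ^ j) - (\<Sum>j=i..k. real (d j) / 2 ^ j)"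
    by (simp add: diff_divide_distrib sum_subtractf)
  also have "(\<Sum>j=i..k. real (d j) / 2 ^ j) = 1 / 2 ^ i + (\<Sum>j=Suc i..k. real (d j) / 2 ^ j)"
    using assms by (simp add: sum.atLeast_Suc_atMost)
  finally have "(\<Sum>j=i..k. (1 - real (d j)) / 2 ^ j) + 1 / 2 ^ k
      = 1 / 2 ^ i - (\<Sum>j=Suc i..k. real (d j) / 2 ^ j)"
    by (simp add: geo)
  then show ?thesis
    using assms(2) by (simp add: real_digit_tail power_diff right_diff_distrib)
qed

lemma tendsto_gap:
  fixes d :: "nat \<Rightarrow> nat"
  assumes d: "\<And>i. d i \<in> {0, 1}"
  shows "(\<lambda>k. \<Sum>j=i..k. (1 - real (d j)) / 2 ^ j) \<longlonglongrightarrow> (\<Sum>j. (1 - real (d (i + j))) / 2 ^ (i + j))"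
proof -
  let ?a = "\<lambda>j. (1 - real (d j)) / 2 ^ j"
  have "norm (?a j) \<le> (1 / 2) ^ j" for j
    using d[of j] by (auto simp: power_one_over)
  then have "summable ?a"
    by (intro summable_comparison_test'[OF summable_geometric[of "1 / 2 :: real"]]) simp_all
  then have "summable (\<lambda>j. ?a (j + i))" by (rule summable_ignore_initial_segment)
  then have "(\<lambda>n. \<Sum>j<n. ?a (j + i)) \<longlonglongrightarrow> (\<Sum>j. ?a (j + i))" by (rule summable_LIMSEQ)
  then have "(\<lambda>k. \<Sum>j<Suc k - i. ?a (j + i)) \<longlonglongrightarrow> (\<Sum>j. ?a (j + i))"
    by (rule filterlim_compose)
       (auto intro!: filterlim_compose[OF filterlim_minus_const_nat_at_top filterlim_Suc])
  moreover have "(\<Sum>j<Suc k - i. ?a (j + i)) = (\<Sum>j=i..k. ?a j)" for k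
    by (rule sum.reindex_bij_witness[of _ "\<lambda>j. j - i" "\<lambda>j. j + i"]) auto
  ultimately show ?thesis by (simp add: add.commute)
qed

text \<open>After cancelling \<open>4 ^ k\<close> the denominator tends to 4/3. This turns the
  coefficient 2 of the squared gap into 3/2, and the leading coefficient 2/3 of the correction into
  1/2.\<close>

lemma tendsto_layer:
  assumes f: "Tb_rule f" and d: "\<And>i. d i \<in> {0, 1}" and "d i = 1"
  shows "(\<lambda>k. real (layer f (k - i) (digit_tail d k (Suc i))) / real (num_b f (2 ^ k))) \<longlonglongrightarrow>
    3 / 2 * (\<Sum>j. (1 - real (d (i + j))) / 2 ^ (i + j))\<^sup>2
    - 1 / (2 * 4 ^ i) * inf_prod_from (i + 1) (\<lambda>j. 1 - real (d j))"
    (is "_ \<longlonglongrightarrow> 3 / 2 * ?S\<^sup>2 - 1 / (2 * 4 ^ i) * ?P")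
proof -
  define r where "r k = (\<Sum>j=i..k. (1 - real (d j)) / 2 ^ j) + (1 / 2) ^ k" for k
  define p where "p k = (\<Prod>j=Suc i..k. 1 - real (d j))" for k
  let ?q = "\<lambda>k. ((2 * (r k)\<^sup>2 + 2 * r k * (1 / 2) ^ k + (1 / 4) ^ k)
      - p k * (2 / 3 / 4 ^ i + 2 / 2 ^ i * (1 / 2) ^ k + 4 / 3 * (1 / 4) ^ k)) / ((4 - (1 / 4) ^ k) / 3)"
  have ratio: "real (layer f (k - i) (digit_tail d k (Suc i))) / real (num_b f (2 ^ k)) = ?q k" if "i \<le> k" for k
  proof -
    have "digit_tail d k (Suc i) \<le> 2 ^ (k - i)"
      using digit_tail_less[of d "Suc i" k] d that by (simp add: less_imp_le)
    then have "real (layer f (k - i) (digit_tail d k (Suc i))) =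
        2 * (2 ^ k * r k)\<^sup>2 + 2 * (2 ^ k * r k) + 1 - p k * (2 / 3 * 4 ^ (k - i) + 2 * 2 ^ (k - i) + 4 / 3)"
      using gap_eq[of d i k] \<open>d i = 1\<close> that
      by (simp add: layer_real[OF f] r_def p_def prod_digits_eq[OF d] power_one_over)
    also have "\<dots> = 4 ^ k * ((2 * (r k)\<^sup>2 + 2 * r k * (1 / 2) ^ k + (1 / 4) ^ k)
      - p k * (2 / 3 / 4 ^ i + 2 / 2 ^ i * (1 / 2) ^ k + 4 / 3 * (1 / 4) ^ k))"
    proof -
      have "((2 :: real) ^ k)\<^sup>2 = 4 ^ k" by (simp add: power2_eq_square flip: power_mult_distrib)
      moreover have "(4 :: real) ^ k * (1 / 2) ^ k = 2 ^ k" "(4 :: real) ^ k * (1 / 4) ^ k = 1"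
        by (simp_all flip: power_mult_distrib)
      ultimately show ?thesis
        using that by (simp add: power_diff power_mult_distrib algebra_simps)
    qed
    finally have layer: "real (layer f (k - i) (digit_tail d k (Suc i))) = \<dots>" .
    have num: "real (num_b f (2 ^ k)) = 4 ^ k * ((4 - (1 / 4) ^ k) / 3)"
      unfolding real_num_b_power_2[OF f] by (simp add: right_diff_distrib power_one_over)
    show ?thesis unfolding layer num by (rule mult_divide_mult_cancel_left) simp
  qed
  have "\<forall>\<^sub>F k in sequentially. ?q k =
      real (layer f (k - i) (digit_tail d k (Suc i))) / real (num_b f (2 ^ k))"
    using eventually_ge_at_top[of i] by eventually_elim (rule ratio[symmetric])
  moreover have "?q \<longlonglongrightarrow> ((2 * ?S\<^sup>2 + 2 * ?S * 0 + 0)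
      - ?P * (2 / 3 / 4 ^ i + 2 / 2 ^ i * 0 + 4 / 3 * 0)) / ((4 - 0) / 3)"
  proof -
    have half: "(\<lambda>k. (1 / 2 :: real) ^ k) \<longlonglongrightarrow> 0" and quarter: "(\<lambda>k. (1 / 4 :: real) ^ k) \<longlonglongrightarrow> 0"
      by (rule LIMSEQ_power_zero; simp)+
    have "r \<longlonglongrightarrow> ?S" unfolding r_def using tendsto_add[OF tendsto_gap[OF d] half] by simp
    moreover have "p \<longlonglongrightarrow> ?P" unfolding p_def using tendsto_inf_prod_from[where m = "Suc i", OF d] by simp
    ultimately show ?thesis by (intro tendsto_intros half quarter) simp_all
  qed
  ultimately have "(\<lambda>k. real (layer f (k - i) (digit_tail d k (Suc i))) / real (num_b f (2 ^ k)))
    \<longlonglongrightarrow> ((2 * ?S\<^sup>2 + 2 * ?S * 0 + 0) - ?P * (2 / 3 / 4 ^ i + 2 / 2 ^ i * 0 + 4 / 3 * 0)) / ((4 - 0) / 3)"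
    by (rule Lim_transform_eventually[rotated])
  moreover have "((2 * s\<^sup>2 + 2 * s * 0 + 0) - p * (2 / 3 / 4 ^ i + 2 / 2 ^ i * 0 + 4 / 3 * 0)) / ((4 - 0) / 3)
      = 3 / 2 * s\<^sup>2 - 1 / (2 * 4 ^ i) * p" for s p :: real
    by (simp add: field_simps)
  ultimately show ?thesis by (simp only:)
qed

lemma G_approx_trunc:
  "G_approx f k (trunc k x) = real (num_b f (digit_tail (bdigit x) k 0)) / real (num_b f (2 ^ k))"
proof -
  have "trunc k x * 2 ^ k = real (digit_tail (bdigit x) k 0)"
    by (simp add: trunc_def real_digit_tail atMost_atLeast0)
  then show ?thesis by (simp add: G_approx_def)
qed

theorem theorem3:
  fixes f :: local_rule
  assumes "Tb_rule f"
  shows "\<forall>x\<in>{0..1}. convergent (\<lambda>k. G_approx f k (trunc k x)) \<and> G f x \<in> {0..1} \<and>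
           (\<lambda>i. real (bdigit x i) * 4 ^ (\<Sum>j<i. bdigit x j) *
              (3 / 2 * (\<Sum>j. (1 - real (bdigit x (i + j))) / 2 ^ (i + j))\<^sup>2
               - 1 / (2 * 4 ^ i) * inf_prod_from (i + 1) (\<lambda>j. 1 - real (bdigit x j)))) sums G f x"
proof
  fix x :: real
  assume "x \<in> {0..1}"
  then have x: "0 \<le> x" "x \<le> 1" by simp_all
  note f = assms
  define d where "d = bdigit x"
  define g where "g k = G_approx f k (trunc k x)" for k
  define term_lim where "term_lim i = real (d i) * 4 ^ (\<Sum>j<i. d j) *
              (3 / 2 * (\<Sum>j. (1 - real (d (i + j))) / 2 ^ (i + j))\<^sup>2
               - 1 / (2 * 4 ^ i) * inf_prod_from (i + 1) (\<lambda>j. 1 - real (d j)))" for i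
  \<comment> \<open>The first \<open>n\<close> terms of the series before the limit in
    \<open>k\<close> is taken.\<close>
  define part where "part k n = (\<Sum>i<n. real (d i) * 4 ^ (\<Sum>j<i. d j) *
      (real (layer f (k - i) (digit_tail d k (Suc i))) / real (num_b f (2 ^ k))))" for k n
  have chosen: "is_chosen_expansion d x"
    unfolding d_def by (rule bdigit_chosen_expansion[OF x])
  then have d01: "\<And>i. d i \<in> {0, 1}" and sums: "(\<lambda>i. real (d i) / 2 ^ i) sums x"
    by (auto simp: is_chosen_expansion_def is_binary_expansion_def)
  have pos: "0 < real (num_b f (2 ^ k))" for k
    using num_b_power_2[OF f, of k] by (cases "num_b f (2 ^ k)") simp_all
  have g: "g k = real (num_b f (digit_tail d k 0)) / real (num_b f (2 ^ k))" for k
    by (simp add: g_def d_def G_approx_trunc)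
  have "(\<lambda>k. part k n) \<longlonglongrightarrow> (\<Sum>i<n. term_lim i)" for n
    unfolding part_def term_lim_def
  proof (intro tendsto_sum)
    fix i
    show "(\<lambda>k. real (d i) * 4 ^ (\<Sum>j<i. d j) *
        (real (layer f (k - i) (digit_tail d k (Suc i))) / real (num_b f (2 ^ k)))) \<longlonglongrightarrow>
      real (d i) * 4 ^ (\<Sum>j<i. d j) * (3 / 2 * (\<Sum>j. (1 - real (d (i + j))) / 2 ^ (i + j))\<^sup>2
        - 1 / (2 * 4 ^ i) * inf_prod_from (i + 1) (\<lambda>j. 1 - real (d j)))"
    proof (cases "d i = 0")
      case False
      then have "d i = 1" using d01[of i] by simp
      then show ?thesis by (intro tendsto_mult_left tendsto_layer[OF f d01])
    qed simp
  qed
  moreover have "(\<lambda>n. 6 * ((4 :: real) ^ (\<Sum>j<n. d j) / 4 ^ n)) \<longlonglongrightarrow> 0"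
    using tendsto_mult_left[OF tendsto_power_4_sum_digits[OF d01 chosen_expansion_infinite_zeros[OF chosen x(2)]], of 6]
    by simp
  \<comment> \<open>What \<open>part\<close> omits is the weighted count of the tail after
    \<open>n\<close> digits. The tail is below \<open>2 ^ (Suc k - n)\<close>, so
    \<open>num_b_le\<close> bounds its count, and the resulting bound is free of
    \<open>k\<close>.\<close>
  moreover have "\<forall>\<^sub>F k in sequentially. \<bar>g k - part k n\<bar> \<le> 6 * (4 ^ (\<Sum>j<n. d j) / 4 ^ n)" for n
    using eventually_ge_at_top[of n]
  proof eventually_elim
    case (elim k)
    then have n: "n \<le> Suc k" by simp
    let ?b = "real (num_b f (digit_tail d k n)) / real (num_b f (2 ^ k))"
    have eq: "g k - part k n = 4 ^ (\<Sum>j<n. d j) * ?b"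
      unfolding g part_def num_b_digit_tail[OF f d01 n]
      by (simp add: add_divide_distrib sum_divide_distrib)
    have "?b \<le> 6 / 4 ^ n"
    proof -
      have "num_b f (digit_tail d k n) \<le> num_b f (2 ^ (Suc k - n))"
        using num_b_le[OF f less_imp_le[OF digit_tail_less[of d, OF d01 n]]] .
      then have "?b \<le> real (num_b f (2 ^ (Suc k - n))) / real (num_b f (2 ^ k))"
        by (simp add: divide_right_mono)
      also note num_b_power_2_ratio_le[OF f n]
      finally show ?thesis .
    qed
    then have "4 ^ (\<Sum>j<n. d j) * ?b \<le> 4 ^ (\<Sum>j<n. d j) * (6 / 4 ^ n)"
      by (rule mult_left_mono) simp
    moreover have "0 \<le> 4 ^ (\<Sum>j<n. d j) * ?b" by simp
    ultimately show ?case unfolding eq by (simp add: mult.commute)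
  qed
  ultimately have conv: "convergent g" and lim: "(\<lambda>n. \<Sum>i<n. term_lim i) \<longlonglongrightarrow> lim g"
    by (rule tendsto_of_truncations[where A = part])+
  have G: "G f x = lim g" by (simp add: G_def g_def[abs_def])
  have "g \<longlonglongrightarrow> lim g" using conv by (simp add: convergent_LIMSEQ_iff)
  moreover have "g k \<in> {0..1}" for k
  proof -
    \<comment> \<open>\<open>digit_tail_less\<close> gives only a bound by \<open>2 ^ Suc k\<close>;
      \<open>x \<le> 1\<close> improves it to \<open>2 ^ k\<close>, which is attained at
      \<open>x = 1\<close>.\<close>
    have "(\<Sum>j<Suc k. real (d j) / 2 ^ j) \<le> x"
      using sum_le_suminf[of "\<lambda>i. real (d i) / 2 ^ i" "{..<Suc k}"] sums by (simp add: sums_iff)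
    then have "(\<Sum>j=0..k. real (d j) / 2 ^ j) \<le> 1"
      using x(2) by (simp add: lessThan_Suc_atMost atMost_atLeast0)
    then have "real (digit_tail d k 0) \<le> real (2 ^ k)"
      unfolding real_digit_tail using mult_left_mono[of _ 1 "2 ^ k :: real"] by simp
    then have "digit_tail d k 0 \<le> 2 ^ k" by (simp only: of_nat_le_iff)
    then show ?thesis unfolding g using num_b_le[OF f] pos[of k] by simp
  qed
  ultimately have "lim g \<in> {0..1}" by (rule closed_sequentially[OF closed_atLeastAtMost, rotated])
  with conv lim show "convergent (\<lambda>k. G_approx f k (trunc k x)) \<and> G f x \<in> {0..1} \<and>
           (\<lambda>i. real (bdigit x i) * 4 ^ (\<Sum>j<i. bdigit x j) *
              (3 / 2 * (\<Sum>j. (1 - real (bdigit x (i + j))) / 2 ^ (i + j))\<^sup>2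
               - 1 / (2 * 4 ^ i) * inf_prod_from (i + 1) (\<lambda>j. 1 - real (bdigit x j)))) sums G f x"
    unfolding G sums_def term_lim_def d_def g_def[abs_def, symmetric] by blast
qed

end
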